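(* Let $\mathfrak g$ be a vector space over a field $\mathbb K$ of characteristic $0$. The graded vector space $\mathfrak C^\bullet(\mathfrak g,\mathfrak g)=\bigoplus_{p\ge 0}\mathfrak C^p(\mathfrak g,\mathfrak g)$, equipped with the graded commutator $$[P,Q]_{\mathsf{LieY}}=P\circ Q-(-1)^{pq}\,Q\circ P,\qquad P\in\mathfrak C^p(\mathfrak g,\mathfrak g),\ Q\in\mathfrak C^q(\mathfrak g,\mathfrak g),$$ is a graded Lie algebra. Moreover, if $\Pi=(\pi,\omega)\in\mathfrak C^1(\mathfrak g,\mathfrak g)$ defines a Lie-Yamaguti algebra structure on $\mathfrak g$ (with binary bracket $\pi$ and ternary bracket $\omega$), then $\Pi$ is a Maurer-Cartan element of the graded Lie algebra $(\mathfrak C^\bullet(\mathfrak g,\mathfrak g),[\cdot,\cdot]_{\mathsf{LieY}})$, i.e. $[\Pi,\Pi]_{\mathsf{LieY}}=0$.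
   Context: Lie-Yamaguti algebra: a vector space $\mathfrak g$ with a bilinear bracket $[\cdot,\cdot]:\wedge^2\mathfrak g\to\mathfrak g$ and a trilinear bracket $[\![\cdot,\cdot,\cdot]\!]:\wedge^2\mathfrak g\otimes\mathfrak g\to\mathfrak g$ such that for all $x,y,z,w,t\in\mathfrak g$: (1) $[[x,y],z]+[[y,z],x]+[[z,x],y]+[\![x,y,z]\!]+[\![y,z,x]\!]+[\![z,x,y]\!]=0$; (2) $[\![[x,y],z,w]\!]+[\![[y,z],x,w]\!]+[\![[z,x],y,w]\!]=0$; (3) $[\![x,y,[z,w]]\!]=[[\![x,y,z]\!],w]+[z,[\![x,y,w]\!]]$; (4) $[\![x,y,[\![z,w,t]\!]]\!]=[\![[\![x,y,z]\!],w,t]\!]+[\![z,[\![x,y,w]\!],t]\!]+[\![z,w,[\![x,y,t]\!]]\!]$. Shuffles: $\mathbb S_{(i,n-i)}$ is the set of permutations $\sigma\in S_n$ with $\sigma(1)<\cdots<\sigma(i)$ and $\sigma(i+1)<\cdots<\sigma(n)$ (only the identity if $i=0$ or $i=n$). The graded space: $\mathfrak C^0(\mathfrak g,\mathfrak g)=\mathrm{Hom}(\mathfrak g,\mathfrak g)$ and, for $p\ge1$, $\mathfrak C^p(\mathfrak g,\mathfrak g)=\mathrm{Hom}((\wedge^2\mathfrak g)^{\otimes p},\mathfrak g)\oplus\mathrm{Hom}((\wedge^2\mathfrak g)^{\otimes p}\otimes\mathfrak g,\mathfrak g)$, in degree $p$; elements are written $P=(P_{\rm I},P_{\rm II})$.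 The operation $\circ$: below $\mathfrak X_i=x_i\wedge y_i\in\wedge^2\mathfrak g$ and $x\in\mathfrak g$. For $P\in\mathfrak C^p$, $Q\in\mathfrak C^q$ with $p,q\ge1$, $P\circ Q=((P\circ Q)_{\rm I},(P\circ Q)_{\rm II})\in\mathfrak C^{p+q}$ is given by $$(P\circ Q)_{\rm I}(\mathfrak X_1,\dots,\mathfrak X_{p+q})=\sum_{\sigma\in\mathbb S_{(p,q)},\,\sigma(p+q)=p+q}(-1)^{pq}\mathrm{sign}(\sigma)P_{\rm II}(\mathfrak X_{\sigma(1)},\dots,\mathfrak X_{\sigma(p)},Q_{\rm I}(\mathfrak X_{\sigma(p+1)},\dots,\mathfrak X_{\sigma(p+q)}))$$ $$+\sum_{k=1}^p(-1)^{(k-1)q}\sum_{\sigma\in\mathbb S_{(k-1,q)}}\mathrm{sign}(\sigma)P_{\rm I}(\mathfrak X_{\sigma(1)},\dots,\mathfrak X_{\sigma(k-1)},x_{k+q}\wedge Q_{\rm II}(\mathfrak X_{\sigma(k)},\dots,\mathfrak X_{\sigma(k+q-1)},y_{k+q}),\mathfrak X_{k+q+1},\dots,\mathfrak X_{p+q})$$ $$+\sum_{k=1}^p(-1)^{(k-1)q}\sum_{\sigma\in\mathbb S_{(k-1,q)}}\mathrm{sign}(\sigma)P_{\rm I}(\mathfrak X_{\sigma(1)},\dots,\mathfrak X_{\sigma(k-1)},Q_{\rm II}(\mathfrak X_{\sigma(k)},\dots,\mathfrak X_{\sigma(k+q-1)},x_{k+q})\wedge y_{k+q},\mathfrak X_{k+q+1},\dots,\mathfrak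 X_{p+q}),$$ and $$(P\circ Q)_{\rm II}(\mathfrak X_1,\dots,\mathfrak X_{p+q},x)=\sum_{\sigma\in\mathbb S_{(p,q)}}(-1)^{pq}\mathrm{sign}(\sigma)P_{\rm II}(\mathfrak X_{\sigma(1)},\dots,\mathfrak X_{\sigma(p)},Q_{\rm II}(\mathfrak X_{\sigma(p+1)},\dots,\mathfrak X_{\sigma(p+q)},x))$$ $$+\sum_{k=1}^p(-1)^{(k-1)q}\sum_{\sigma\in\mathbb S_{(k-1,q)}}\mathrm{sign}(\sigma)P_{\rm II}(\mathfrak X_{\sigma(1)},\dots,\mathfrak X_{\sigma(k-1)},x_{k+q}\wedge Q_{\rm II}(\mathfrak X_{\sigma(k)},\dots,\mathfrak X_{\sigma(k+q-1)},y_{k+q}),\mathfrak X_{k+q+1},\dots,\mathfrak X_{p+q},x)$$ $$+\sum_{k=1}^p(-1)^{(k-1)q}\sum_{\sigma\in\mathbb S_{(k-1,q)}}\mathrm{sign}(\sigma)P_{\rm II}(\mathfrak X_{\sigma(1)},\dots,\mathfrak X_{\sigma(k-1)},Q_{\rm II}(\mathfrak X_{\sigma(k)},\dots,\mathfrak X_{\sigma(k+q-1)},x_{k+q})\wedge y_{k+q},\mathfrak X_{k+q+1},\dots,\mathfrak X_{p+q},x).$$ For $f,g\in\mathfrak C^0$ and $P\in\mathfrak C^p$ ($p\ge1$): $f\circ g$ is composition; $(f\circ P)_{\rm I}=f\circ P_{\rm I}$, $(f\circ P)_{\rm II}=f\circ P_{\rm II}$ (compositions); $(P\circ f)_{\rm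 I}(\mathfrak X_1,\dots,\mathfrak X_p)=\sum_{k=1}^pP_{\rm I}(\mathfrak X_1,\dots,\mathfrak X_{k-1},x_k\wedge f(y_k)+f(x_k)\wedge y_k,\mathfrak X_{k+1},\dots,\mathfrak X_p)$; $(P\circ f)_{\rm II}(\mathfrak X_1,\dots,\mathfrak X_p,x)=\sum_{k=1}^pP_{\rm II}(\mathfrak X_1,\dots,\mathfrak X_{k-1},x_k\wedge f(y_k)+f(x_k)\wedge y_k,\mathfrak X_{k+1},\dots,\mathfrak X_p,x)+P_{\rm II}(\mathfrak X_1,\dots,\mathfrak X_p,f(x))$. A Maurer-Cartan element of a graded Lie algebra is a degree $1$ element $a$ with $[a,a]=0$. *)

theory Defs
  imports
    Complex_Main
    "HOL-Combinatorics.Permutations"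
    "HOL-Library.Function_Algebras"
    "HOL-Library.Product_Plus"
begin

locale graded_vector_space = vector_space scale
  for scale :: "'k::field \<Rightarrow> 'a::ab_group_add \<Rightarrow> 'a" +
  fixes V :: "nat \<Rightarrow> 'a set"
  assumes component_subspace: "subspace (V p)"
    and components_independent: "V p \<inter> span (\<Union>q\<in>-{p}. V q) = {0}"
begin

text \<open>The internal direct sum of the homogeneous components.\<close>

definition total :: "'a set" where
  "total = span (\<Union>p. V p)"

end

locale graded_lie_algebra = graded_vector_space scale V
  for scale :: "'k::field \<Rightarrow> 'a::ab_group_add \<Rightarrow> 'a" and V :: "nat \<Rightarrow> 'a set" +
  fixes bracket :: "'a \<Rightarrow> 'a \<Rightarrow> 'a"
  assumes bracket_add_left:
      "\<lbrakk>a \<in> total; b \<in> total; c \<in> total\<rbrakk> \<Longrightarrow> bracket (a + b) c = bracket a c + bracket b c"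
    and bracket_add_right:
      "\<lbrakk>a \<in> total; b \<in> total; c \<in> total\<rbrakk> \<Longrightarrow> bracket a (b + c) = bracket a b + bracket a c"
    and bracket_scale_left:
      "\<lbrakk>a \<in> total; b \<in> total\<rbrakk> \<Longrightarrow> bracket (scale t a) b = scale t (bracket a b)"
    and bracket_scale_right:
      "\<lbrakk>a \<in> total; b \<in> total\<rbrakk> \<Longrightarrow> bracket a (scale t b) = scale t (bracket a b)"
    and bracket_degree:
      "\<lbrakk>a \<in> V p; b \<in> V q\<rbrakk> \<Longrightarrow> bracket a b \<in> V (p + q)"
    and graded_skew_symmetry:
      "\<lbrakk>a \<in> V p; b \<in> V q\<rbrakk> \<Longrightarrow> bracket a b = - scale ((-1) ^ (p * q)) (bracket b a)"
    and graded_jacobi: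
      "\<lbrakk>a \<in> V p; b \<in> V q; c \<in> V r\<rbrakk> \<Longrightarrow>
        bracket a (bracket b c) =
          bracket (bracket a b) c + scale ((-1) ^ (p * q)) (bracket b (bracket a c))"

definition maurer_cartan_element ::
  "(nat \<Rightarrow> 'a::zero set) \<Rightarrow> ('a \<Rightarrow> 'a \<Rightarrow> 'a) \<Rightarrow> 'a \<Rightarrow> bool" where
  "maurer_cartan_element V bracket a \<longleftrightarrow> a \<in> V 1 \<and> bracket a a = 0"

text \<open>A linear map out of the exterior square of \<open>g\<close> is represented throughout by the alternating
  bilinear map on \<open>g\<close> that corresponds to it by the universal property.\<close>

definition alternating_bilinear ::
  "('k::field \<Rightarrow> 'v::ab_group_add \<Rightarrow> 'v) \<Rightarrow> ('v \<Rightarrow> 'v \<Rightarrow> 'v) \<Rightarrow> bool" where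
  "alternating_bilinear scale f \<longleftrightarrow>
    (\<forall>y. Vector_Spaces.linear scale scale (\<lambda>x. f x y)) \<and>
    (\<forall>x. Vector_Spaces.linear scale scale (\<lambda>y. f x y)) \<and>
    (\<forall>x. f x x = 0)"

locale lie_yamaguti_algebra = vector_space scale
  for scale :: "'k::field \<Rightarrow> 'v::ab_group_add \<Rightarrow> 'v" +
  fixes B :: "'v \<Rightarrow> 'v \<Rightarrow> 'v"
    and T :: "'v \<Rightarrow> 'v \<Rightarrow> 'v \<Rightarrow> 'v"
  assumes binary: "alternating_bilinear scale B"
    and ternary_alternating: "\<And>z. alternating_bilinear scale (\<lambda>x y. T x y z)"
    and ternary_linear: "\<And>x y. Vector_Spaces.linear scale scale (T x y)"
    and LY1: "B (B x y) z + B (B y z) x + B (B z x) y + T x y z + T y z x + T z x y = 0"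
    and LY2: "T (B x y) z w + T (B y z) x w + T (B z x) y w = 0"
    and LY3: "T x y (B z w) = B (T x y z) w + B z (T x y w)"
    and LY4: "T x y (T z w t) = T (T x y z) w t + T z (T x y w) t + T z w (T x y t)"

text \<open>A list \<open>[(x\<^sub>1,y\<^sub>1), \<dots>, (x\<^sub>p,y\<^sub>p)]\<close> stands for
  \<open>(x\<^sub>1 \<and> y\<^sub>1) \<otimes> \<dots> \<otimes> (x\<^sub>p \<and> y\<^sub>p)\<close>, and a linear map on the \<open>p\<close>-th tensor power of the exterior
  square for the corresponding function of \<open>p\<close> pairs, alternating bilinear in each pair.
  Cochains of degree \<open>p\<close> vanish on lists of length other than \<open>p\<close>; a function on lists of all
  lengths is thus the family of its homogeneous components.\<close>

type_synonym 'v cochain = "(('v \<times> 'v) list \<Rightarrow> 'v) \<times> (('v \<times> 'v) list \<Rightarrow> 'v \<Rightarrow> 'v)"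

definition cochain_scale ::
  "('k \<Rightarrow> 'v \<Rightarrow> 'v) \<Rightarrow> 'k \<Rightarrow> 'v cochain \<Rightarrow> 'v cochain" where
  "cochain_scale scale c P = (\<lambda>Xs. scale c (fst P Xs), \<lambda>Xs x. scale c (snd P Xs x))"

definition hom_I ::
  "('k::field \<Rightarrow> 'v::ab_group_add \<Rightarrow> 'v) \<Rightarrow> nat \<Rightarrow> (('v \<times> 'v) list \<Rightarrow> 'v) set" where
  "hom_I scale p = {F.
    (\<forall>Xs. length Xs \<noteq> p \<longrightarrow> F Xs = 0) \<and>
    (\<forall>Xs k. length Xs = p \<and> k < p \<longrightarrow> alternating_bilinear scale (\<lambda>a b. F (Xs[k := (a, b)])))}"

definition hom_II ::
  "('k::field \<Rightarrow> 'v::ab_group_add \<Rightarrow> 'v) \<Rightarrow> nat \<Rightarrow> (('v \<times> 'v) list \<Rightarrow> 'v \<Rightarrow> 'v) set" where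
  "hom_II scale p = {F.
    (\<forall>Xs x. length Xs \<noteq> p \<longrightarrow> F Xs x = 0) \<and>
    (\<forall>Xs. length Xs = p \<longrightarrow> Vector_Spaces.linear scale scale (F Xs)) \<and>
    (\<forall>Xs x k. length Xs = p \<and> k < p \<longrightarrow>
      alternating_bilinear scale (\<lambda>a b. F (Xs[k := (a, b)]) x))}"

text \<open>In degree \<open>0\<close> there is no first component: an endomorphism \<open>f\<close> is \<open>P\<close> with
  \<open>fst P = 0\<close> and \<open>snd P [] = f\<close>.\<close>

definition cochains ::
  "('k::field \<Rightarrow> 'v::ab_group_add \<Rightarrow> 'v) \<Rightarrow> nat \<Rightarrow> 'v cochain set" where
  "cochains scale p = (if p = 0 then {0} else hom_I scale p) \<times> hom_II scale p"

definition shuffle_perms :: "nat \<Rightarrow> nat \<Rightarrow> (nat \<Rightarrow> nat) set" where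
  "shuffle_perms i j = {\<sigma>. \<sigma> permutes {1..i + j} \<and>
     strict_mono_on {1..i} \<sigma> \<and> strict_mono_on {i + 1..i + j} \<sigma>}"

text \<open>\<open>elt Xs i\<close> is the \<open>i\<close>-th entry in the one-based numbering of the formulas.\<close>

definition elt :: "'a list \<Rightarrow> nat \<Rightarrow> 'a" where
  "elt Xs i = Xs ! (i - 1)"

text \<open>The two sums over \<open>k = 1, \<dots>, p\<close> are the same in both components of \<open>P \<circ> Q\<close>, with
  \<open>F\<close> being \<open>P\<^sub>I\<close> or \<open>P\<^sub>I\<^sub>I(\<dots>, x)\<close>.\<close>

definition insertion_sum ::
  "('k::field \<Rightarrow> 'v::ab_group_add \<Rightarrow> 'v) \<Rightarrow> nat \<Rightarrow> nat \<Rightarrow>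
   (('v \<times> 'v) list \<Rightarrow> 'v) \<Rightarrow> 'v cochain \<Rightarrow> ('v \<times> 'v) list \<Rightarrow> 'v" where
  "insertion_sum scale p q F Q Xs =
    (let X = elt Xs; x = (\<lambda>i. fst (X i)); y = (\<lambda>i. snd (X i)) in
      (\<Sum>k = 1..p. scale ((-1) ^ ((k - 1) * q)) (\<Sum>\<sigma>\<in>shuffle_perms (k - 1) q. scale (of_int (sign \<sigma>))
        (F (map (\<lambda>i. X (\<sigma> i)) [1..<k] @
            [(x (k + q), snd Q (map (\<lambda>i. X (\<sigma> i)) [k..<k + q]) (y (k + q)))] @
            map X [k + q + 1..<p + q + 1])))) +
      (\<Sum>k = 1..p. scale ((-1) ^ ((k - 1) * q)) (\<Sum>\<sigma>\<in>shuffle_perms (k - 1) q. scale (of_int (sign \<sigma>))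
        (F (map (\<lambda>i. X (\<sigma> i)) [1..<k] @
            [(snd Q (map (\<lambda>i. X (\<sigma> i)) [k..<k + q]) (x (k + q)), y (k + q))] @
            map X [k + q + 1..<p + q + 1])))))"

definition circ_pos_I ::
  "('k::field \<Rightarrow> 'v::ab_group_add \<Rightarrow> 'v) \<Rightarrow> nat \<Rightarrow> nat \<Rightarrow>
   'v cochain \<Rightarrow> 'v cochain \<Rightarrow> ('v \<times> 'v) list \<Rightarrow> 'v" where
  "circ_pos_I scale p q P Q Xs =
    (\<Sum>\<sigma>\<in>{\<sigma> \<in> shuffle_perms p q. \<sigma> (p + q) = p + q}.
      scale ((-1) ^ (p * q) * of_int (sign \<sigma>))
        (snd P (map (\<lambda>i. elt Xs (\<sigma> i)) [1..<p + 1])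
          (fst Q (map (\<lambda>i. elt Xs (\<sigma> i)) [p + 1..<p + q + 1])))) +
    insertion_sum scale p q (fst P) Q Xs"

definition circ_pos_II ::
  "('k::field \<Rightarrow> 'v::ab_group_add \<Rightarrow> 'v) \<Rightarrow> nat \<Rightarrow> nat \<Rightarrow>
   'v cochain \<Rightarrow> 'v cochain \<Rightarrow> ('v \<times> 'v) list \<Rightarrow> 'v \<Rightarrow> 'v" where
  "circ_pos_II scale p q P Q Xs x =
    (\<Sum>\<sigma>\<in>shuffle_perms p q.
      scale ((-1) ^ (p * q) * of_int (sign \<sigma>))
        (snd P (map (\<lambda>i. elt Xs (\<sigma> i)) [1..<p + 1])
          (snd Q (map (\<lambda>i. elt Xs (\<sigma> i)) [p + 1..<p + q + 1]) x))) +
    insertion_sum scale p q (\<lambda>Ys. snd P Ys x) Q Xs"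

text \<open>\<open>F(X\<^sub>1, \<dots>, x\<^sub>k \<and> f(y\<^sub>k) + f(x\<^sub>k) \<and> y\<^sub>k, \<dots>, X\<^sub>p)\<close>, summed over \<open>k\<close> and expanded by linearity
  of \<open>F\<close> in the \<open>k\<close>-th argument, which is \<open>Xs ! (k - 1)\<close>.\<close>

definition derivation_sum ::
  "nat \<Rightarrow> (('v \<times> 'v) list \<Rightarrow> 'v::ab_group_add) \<Rightarrow> ('v \<Rightarrow> 'v) \<Rightarrow> ('v \<times> 'v) list \<Rightarrow> 'v" where
  "derivation_sum p F f Xs =
    (\<Sum>k = 1..p. F (Xs[k - 1 := (fst (elt Xs k), f (snd (elt Xs k)))]) +
                 F (Xs[k - 1 := (f (fst (elt Xs k)), snd (elt Xs k))]))"

definition circ ::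
  "('k::field \<Rightarrow> 'v::ab_group_add \<Rightarrow> 'v) \<Rightarrow> nat \<Rightarrow> nat \<Rightarrow>
   'v cochain \<Rightarrow> 'v cochain \<Rightarrow> 'v cochain" where
  "circ scale p q P Q =
    (\<lambda>Xs. if length Xs \<noteq> p + q then 0
          else if p = 0 \<and> q = 0 then 0
          else if p = 0 then snd P [] (fst Q Xs)
          else if q = 0 then derivation_sum p (fst P) (snd Q []) Xs
          else circ_pos_I scale p q P Q Xs,
     \<lambda>Xs x. if length Xs \<noteq> p + q then 0
          else if p = 0 then snd P [] (snd Q Xs x)
          else if q = 0 then
            derivation_sum p (\<lambda>Ys. snd P Ys x) (snd Q []) Xs + snd P Xs (snd Q [] x)
          else circ_pos_II scale p q P Q Xs x)"

definition graded_commutator ::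
  "('k::field \<Rightarrow> 'v::ab_group_add \<Rightarrow> 'v) \<Rightarrow> nat \<Rightarrow> nat \<Rightarrow>
   'v cochain \<Rightarrow> 'v cochain \<Rightarrow> 'v cochain" where
  "graded_commutator scale p q P Q =
    circ scale p q P Q - cochain_scale scale ((-1) ^ (p * q)) (circ scale q p Q P)"

definition homogeneous_part :: "nat \<Rightarrow> 'v::zero cochain \<Rightarrow> 'v cochain" where
  "homogeneous_part p P =
    (\<lambda>Xs. if length Xs = p then fst P Xs else 0, \<lambda>Xs x. if length Xs = p then snd P Xs x else 0)"

definition degree_support :: "'v::zero cochain \<Rightarrow> nat set" where
  "degree_support P = {p. homogeneous_part p P \<noteq> 0}"

text \<open>The biadditive extension of the graded commutator to the direct sum; only its values on
  elements of finite degree support are meaningful.\<close>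

definition lieY_bracket ::
  "('k::field \<Rightarrow> 'v::ab_group_add \<Rightarrow> 'v) \<Rightarrow> 'v cochain \<Rightarrow> 'v cochain \<Rightarrow> 'v cochain" where
  "lieY_bracket scale P Q =
    (\<Sum>p\<in>degree_support P. \<Sum>q\<in>degree_support Q.
      graded_commutator scale p q (homogeneous_part p P) (homogeneous_part q Q))"

lemma homogeneous_part_cochains:
  assumes "P \<in> cochains scale p"
  shows "homogeneous_part q P = (if q = p then P else 0)"
  using assms
  by (cases P)
    (auto simp: cochains_def hom_I_def hom_II_def homogeneous_part_def fun_eq_iff zero_prod_def
      split: if_splits)

lemma linear_map_zero: "Vector_Spaces.linear s s f \<Longrightarrow> f 0 = 0"
  unfolding Vector_Spaces.linear_def using module_hom.zero by blast

lemma alternating_bilinear_zero: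
  assumes "alternating_bilinear s f" shows "f 0 b = 0" "f a 0 = 0"
  using assms linear_map_zero[of s "\<lambda>a. f a b"] linear_map_zero[of s "f a"]
  by (simp_all add: alternating_bilinear_def)

lemma circ_zero_left:
  assumes "vector_space scale"
  shows "circ scale p q 0 Q = 0"
proof -
  interpret vector_space scale by fact
  show ?thesis
    by (auto simp: circ_def circ_pos_I_def circ_pos_II_def insertion_sum_def derivation_sum_def
        zero_prod_def fun_eq_iff Let_def)
qed

lemma circ_zero_right:
  assumes "vector_space scale" and P: "P \<in> cochains scale p"
  shows "circ scale p q P 0 = 0"
proof -
  interpret vector_space scale by fact
  have lin: "snd P Xs 0 = 0" if "length Xs = p" for Xs
    using P that by (intro linear_map_zero[of scale]) (auto simp: cochains_def hom_II_def)
  have homI: "alternating_bilinear scale (\<lambda>a b. fst P (Xs[k := (a, b)]))"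
    if "length Xs = p" "k < p" for Xs k
    using P that by (auto simp: cochains_def hom_I_def split: if_splits)
  have homII: "alternating_bilinear scale (\<lambda>a b. snd P (Xs[k := (a, b)]) x)"
    if "length Xs = p" "k < p" for Xs k x
    using P that by (auto simp: cochains_def hom_II_def)
  have I: "fst P (As @ (a, b) # Bs) = 0"
    if "length As + length Bs + 1 = p" "a = 0 \<or> b = 0" for As Bs a b
  proof -
    have "alternating_bilinear scale
        (\<lambda>a b. fst P ((As @ (a, b) # Bs)[length As := (a, b)]))"
      using homI[of "As @ (a, b) # Bs" "length As"] that by simp
    from alternating_bilinear_zero[OF this] show ?thesis using that(2) by auto
  qed
  have II: "snd P (As @ (a, b) # Bs) x = 0"
    if "length As + length Bs + 1 = p" "a = 0 \<or> b = 0" for As Bs a b x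
  proof -
    have "alternating_bilinear scale
        (\<lambda>a b. snd P ((As @ (a, b) # Bs)[length As := (a, b)]) x)"
      using homII[of "As @ (a, b) # Bs" "length As" x] that by simp
    from alternating_bilinear_zero[OF this] show ?thesis using that(2) by auto
  qed
  have dI: "derivation_sum p (fst P) (\<lambda>_. 0) Xs = 0" if "length Xs = p" for Xs
    unfolding derivation_sum_def
    by (rule sum.neutral) (use that alternating_bilinear_zero[OF homI] in auto)
  have dII: "derivation_sum p (\<lambda>Ys. snd P Ys x) (\<lambda>_. 0) Xs = 0" if "length Xs = p" for Xs x
    unfolding derivation_sum_def
    by (rule sum.neutral) (use that alternating_bilinear_zero[OF homII] in auto)
  have iI: "insertion_sum scale p q (fst P) (\<lambda>_. 0, \<lambda>_ _. 0) Xs = 0" for Xs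
    by (auto simp: insertion_sum_def Let_def I intro!: sum.neutral)
  have iII: "insertion_sum scale p q (\<lambda>Ys. snd P Ys x) (\<lambda>_. 0, \<lambda>_ _. 0) Xs = 0" for Xs x
    by (auto simp: insertion_sum_def Let_def II intro!: sum.neutral)
  show ?thesis
    by (auto simp: circ_def circ_pos_I_def circ_pos_II_def iI iII dI dII lin zero_fun_def
        zero_prod_def fun_eq_iff)
qed

lemma lieY_bracket_homogeneous:
  assumes "vector_space scale" "P \<in> cochains scale p" "Q \<in> cochains scale q"
  shows "lieY_bracket scale P Q =
    circ scale p q P Q - cochain_scale scale ((-1) ^ (p * q)) (circ scale q p Q P)"
proof -
  interpret vector_space scale by fact
  have cs0: "cochain_scale scale c 0 = 0" for c
    by (auto simp: cochain_scale_def zero_prod_def fun_eq_iff)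
  have "degree_support P = (if P = 0 then {} else {p})"
       "degree_support Q = (if Q = 0 then {} else {q})"
    using homogeneous_part_cochains[OF assms(2)] homogeneous_part_cochains[OF assms(3)]
    by (auto simp: degree_support_def)
  then show ?thesis
    using assms homogeneous_part_cochains[OF assms(2)] homogeneous_part_cochains[OF assms(3)]
    by (auto simp: lieY_bracket_def graded_commutator_def circ_zero_left circ_zero_right cs0)
qed

end

theory Submission
  imports Defs
begin

text \<open>
  The operation \<open>\<circ>\<close> is a graded right pre-Lie product: the associator
  \<open>(F \<circ> P) \<circ> Q - F \<circ> (P \<circ> Q)\<close> is graded symmetric in \<open>P\<close> and \<open>Q\<close>, and this formally implies the
  graded Jacobi identity of the commutator. To see the symmetry, expand every cochain along its
  first argument. In the shuffle formula for \<open>F \<circ> Q\<close> the argument \<open>X\<^sub>1\<close> is either acted on by \<open>Q\<close>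
  (possible only if \<open>Q\<close> has degree \<open>0\<close>), or is the first argument of \<open>Q\<close>, or is the first
  argument of \<open>F\<close>. Writing \<open>\<iota>\<close> for the contraction with \<open>X\<^sub>1\<close> and \<open>q\<close> for the degree of \<open>Q\<close>, this
  gives \<open>\<iota> (F \<circ> Q) = F (Q \<cdot> X\<^sub>1, \<dots>) + F \<circ> \<iota> Q + (-1)\<^sup>q \<iota> F \<circ> Q\<close>, from which the symmetry follows by
  induction on the number of arguments, the leftover terms
  \<open>F (P x \<and> Q y, \<dots>) + F (Q x \<and> P y, \<dots>)\<close> being visibly symmetric. For \<open>\<Pi> = (\<pi>, \<omega>)\<close> the two
  components of \<open>\<Pi> \<circ> \<Pi> = 0\<close> are (3) and (4).
\<close>

section \<open>The pre-Lie identity\<close>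

text \<open>Two obstacles shape the proof. First, the formulas for \<open>circ\<close> number the
  arguments by permutations, while the pre-Lie identity wants them peeled off one by one. Deleting
  the smallest value of a shuffle shifts all others, deleting the largest shifts none; so the
  recursion at the front is unrolled into a signed sum over splittings of the list, and that sum is
  matched with the sum over shuffles by induction from the back. Second, swapping P and Q should
  cost the sign (-1)^(pq), yet the leftover terms are symmetric without a sign. Each of them
  contains a value of \<open>P []\<close> or \<open>Q []\<close> on a vector, so it vanishes unless
  that cochain has even degree, and then pq is even. Only parities enter here, which is why the
  identity holds for multilinear functions on lists of all lengths under the weak condition
  \<open>odd_part_vanishes\<close>, which survives contraction. The clauses of \<open>circ\<close>
  in degree 0 turn out to be the general formula at p = 0 or q = 0, so one argument covers all
  degrees.\<close>

text \<open>The two components of a cochain are merged into one function of a list of pairs and an end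
  \<open>e\<close>: in the second component the end is the vector \<open>x\<close> (\<open>Inl\<close>), in the first it is the last
  pair \<open>X\<^sub>p\<close> (\<open>Inr\<close>), which by the condition \<open>\<sigma> (p + q) = p + q\<close> plays the same role.\<close>

type_synonym 'v joint_cochain = "('v \<times> 'v) list \<Rightarrow> 'v + 'v \<times> 'v \<Rightarrow> 'v"

definition joint :: "'v cochain \<Rightarrow> 'v joint_cochain" where
  "joint P Xs e = (case e of Inl x \<Rightarrow> snd P Xs x | Inr X \<Rightarrow> fst P (Xs @ [X]))"

definition contract :: "'a \<Rightarrow> ('a list \<Rightarrow> 'b) \<Rightarrow> 'a list \<Rightarrow> 'b" where
  "contract X F = (\<lambda>Ys. F (X # Ys))"

text \<open>A sign acts on every abelian group, so it applies alike to vectors and to whole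
  cochains, and signs can be compared by parity cases without scalars.\<close>

definition parity_sign :: "nat \<Rightarrow> 'a::ab_group_add \<Rightarrow> 'a" where
  "parity_sign n v = (if even n then v else - v)"

text \<open>Only the parity of the degree \<open>q\<close> of \<open>Q\<close> matters, so contraction, which lowers the degree
  by one, may be accompanied by \<open>Suc q\<close>; this avoids truncated subtraction at degree \<open>0\<close>.\<close>

fun joint_circ ::
  "nat \<Rightarrow> 'v::ab_group_add joint_cochain \<Rightarrow> 'v joint_cochain \<Rightarrow> 'v joint_cochain" where
  "joint_circ q F Q [] (Inl x) = F [] (Inl (Q [] (Inl x)))"
| "joint_circ q F Q [] (Inr (x, y)) =
    F [] (Inl (Q [] (Inr (x, y)))) +
    F [] (Inr (x, Q [] (Inl y))) + F [] (Inr (Q [] (Inl x), y))"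
| "joint_circ q F Q (X # Xs) e =
    F ((fst X, Q [] (Inl (snd X))) # Xs) e + F ((Q [] (Inl (fst X)), snd X) # Xs) e +
    joint_circ (Suc q) F (contract X Q) Xs e +
    parity_sign q (joint_circ q (contract X F) Q Xs e)"

text \<open>The lists may have any length: without a degree the class is closed under contraction,
  and inductions over the list carry no length condition.\<close>

definition multilinear ::
  "('k::field \<Rightarrow> 'v::ab_group_add \<Rightarrow> 'v) \<Rightarrow> 'v joint_cochain \<Rightarrow> bool" where
  "multilinear scale F \<longleftrightarrow>
    (\<forall>As Bs e. alternating_bilinear scale (\<lambda>a b. F (As @ (a, b) # Bs) e)) \<and>
    (\<forall>As. Vector_Spaces.linear scale scale (\<lambda>x. F As (Inl x))) \<and>
    (\<forall>As. alternating_bilinear scale (\<lambda>a b. F As (Inr (a, b))))"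

lemma linear_mapD:
  assumes "Vector_Spaces.linear s s f"
  shows "f (a + b) = f a + f b" "f (s c a) = s c (f a)"
  using assms by (simp_all add: Vector_Spaces.linear_iff)

lemma alternating_bilinear_add_args:
  assumes "alternating_bilinear s f"
  shows "f (a + b) c = f a c + f b c" "f c (a + b) = f c a + f c b"
  by (rule linear_mapD(1)[of s "\<lambda>x. f x c"] linear_mapD(1)[of s "f c"],
      use assms in \<open>simp add: alternating_bilinear_def\<close>)+

lemma alternating_bilinear_skew:
  assumes "alternating_bilinear s f"
  shows "f x y + f y x = 0"
proof -
  have "f (x + y) (x + y) = f x x + f x y + (f y x + f y y)"
    by (simp only: alternating_bilinear_add_args[OF assms] add_ac)
  then show ?thesis
    using assms by (simp add: alternating_bilinear_def)
qed

lemma multilinear_head: "multilinear s F \<Longrightarrow> alternating_bilinear s (\<lambda>a b. F ((a, b) # Bs) e)"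
  unfolding multilinear_def by (drule conjunct1, drule spec[of _ "[]"]) simp

lemma multilinear_contract:
  assumes "multilinear s F"
  shows "multilinear s (contract X F)"
proof -
  have "alternating_bilinear s (\<lambda>a b. F ((X # As) @ (a, b) # Bs) e)" for As Bs e
    using assms unfolding multilinear_def by (elim conjE) (erule allE)+
  then show ?thesis
    using assms by (simp add: multilinear_def contract_def)
qed

lemma multilinear_add_args:
  assumes "multilinear s F"
  shows "F ((a + b, c) # Bs) e = F ((a, c) # Bs) e + F ((b, c) # Bs) e"
    "F ((c, a + b) # Bs) e = F ((c, a) # Bs) e + F ((c, b) # Bs) e"
    "F As (Inl (a + b)) = F As (Inl a) + F As (Inl b)"
    "F As (Inr (a + b, c)) = F As (Inr (a, c)) + F As (Inr (b, c))"
    "F As (Inr (c, a + b)) = F As (Inr (c, a)) + F As (Inr (c, b))"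
proof -
  show "F ((a + b, c) # Bs) e = F ((a, c) # Bs) e + F ((b, c) # Bs) e"
    by (rule alternating_bilinear_add_args(1)[OF multilinear_head[OF assms]])
  show "F ((c, a + b) # Bs) e = F ((c, a) # Bs) e + F ((c, b) # Bs) e"
    by (rule alternating_bilinear_add_args(2)[OF multilinear_head[OF assms]])
  have alt: "alternating_bilinear s (\<lambda>a b. F As (Inr (a, b)))"
    using assms unfolding multilinear_def by blast
  show "F As (Inr (a + b, c)) = F As (Inr (a, c)) + F As (Inr (b, c))"
    by (rule alternating_bilinear_add_args(1)[OF alt])
  show "F As (Inr (c, a + b)) = F As (Inr (c, a)) + F As (Inr (c, b))"
    by (rule alternating_bilinear_add_args(2)[OF alt])
  have "Vector_Spaces.linear s s (\<lambda>x. F As (Inl x))"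
    using assms unfolding multilinear_def by blast
  then show "F As (Inl (a + b)) = F As (Inl a) + F As (Inl b)"
    by (rule linear_mapD(1))
qed

lemma additive_zero_neg:
  fixes f :: "'a::ab_group_add \<Rightarrow> 'b::ab_group_add"
  assumes "\<And>a b. f (a + b) = f a + f b"
  shows "f 0 = 0" "f (- a) = - f a"
  using additive.zero[of f] additive.minus[of f a] assms by (simp_all add: additive_def)

lemma multilinear_zero_args:
  assumes "multilinear s F"
  shows "F ((0, c) # Bs) e = 0" "F ((c, 0) # Bs) e = 0" "F As (Inl 0) = 0"
    "F As (Inr (0, c)) = 0" "F As (Inr (c, 0)) = 0"
  by (fact
    additive_zero_neg(1)[of "\<lambda>a. F ((a, c) # Bs) e", OF multilinear_add_args(1)[OF assms]]
    additive_zero_neg(1)[of "\<lambda>a. F ((c, a) # Bs) e", OF multilinear_add_args(2)[OF assms]]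
    additive_zero_neg(1)[of "\<lambda>a. F As (Inl a)", OF multilinear_add_args(3)[OF assms]]
    additive_zero_neg(1)[of "\<lambda>a. F As (Inr (a, c))", OF multilinear_add_args(4)[OF assms]]
    additive_zero_neg(1)[of "\<lambda>a. F As (Inr (c, a))", OF multilinear_add_args(5)[OF assms]])+

section \<open>Additivity of the composition in both cochains\<close>

lemma contract_add: "contract X (F + G) = contract X F + contract X G"
  by (simp add: contract_def fun_eq_iff)

lemma parity_sign_add: "parity_sign n (a + b) = parity_sign n a + parity_sign n b"
  by (simp add: parity_sign_def)

lemma parity_sign_zero: "parity_sign n 0 = 0"
  by (simp add: parity_sign_def)

lemma parity_sign_apply: "parity_sign n F x = parity_sign n (F x)"
  by (simp add: parity_sign_def)

lemma joint_circ_add_left: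
  "joint_circ q (F + G) Q = joint_circ q F Q + joint_circ q G Q"
proof -
  have "joint_circ q (F + G) Q Xs e = joint_circ q F Q Xs e + joint_circ q G Q Xs e" for Xs e
  proof (induction q F Q Xs e arbitrary: G rule: joint_circ.induct)
    case (3 q F Q X Xs e)
    show ?case
      unfolding joint_circ.simps contract_add "3.IH" by (simp add: parity_sign_add add_ac)
  qed (simp_all add: add_ac)
  then show ?thesis by (simp add: fun_eq_iff)
qed

lemma joint_circ_uminus_left: "joint_circ q (- F) Q = - joint_circ q F Q"
  by (rule additive_zero_neg(2)[of "\<lambda>F. joint_circ q F Q", OF joint_circ_add_left])

lemma joint_circ_zero_left: "joint_circ q 0 Q = 0"
  by (rule additive_zero_neg(1)[of "\<lambda>F. joint_circ q F Q", OF joint_circ_add_left])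

text \<open>The values of \<open>P + Q\<close> are fed into \<open>F\<close>, so here
  \<open>F\<close> itself has to be additive in its arguments; in the left slot additivity is
  free.\<close>

lemma joint_circ_add_right:
  assumes "multilinear s F"
  shows "joint_circ q F (P + Q) = joint_circ q F P + joint_circ q F Q"
proof -
  have "joint_circ q F (P + Q) Xs e = joint_circ q F P Xs e + joint_circ q F Q Xs e" for Xs e
    using assms
  proof (induction q F P Xs e arbitrary: Q rule: joint_circ.induct)
    case (3 q F P X Xs e)
    show ?case
      unfolding joint_circ.simps contract_add "3.IH"(1)[OF "3.prems"]
        "3.IH"(2)[OF multilinear_contract[OF "3.prems"]]
      by (simp add: multilinear_add_args[OF "3.prems"] parity_sign_add add_ac)
  qed (simp_all add: multilinear_add_args add_ac)
  then show ?thesis by (simp add: fun_eq_iff)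
qed

lemma joint_circ_uminus_right:
  "multilinear s F \<Longrightarrow> joint_circ q F (- Q) = - joint_circ q F Q"
  by (rule additive_zero_neg(2)[of "joint_circ q F", OF joint_circ_add_right])

lemma joint_circ_zero_right:
  "multilinear s F \<Longrightarrow> joint_circ q F 0 = 0"
  by (rule additive_zero_neg(1)[of "joint_circ q F", OF joint_circ_add_right])

lemma joint_circ_parity_sign_left:
  "joint_circ q (parity_sign n F) Q = parity_sign n (joint_circ q F Q)"
  by (simp add: parity_sign_def joint_circ_uminus_left)

lemma joint_circ_parity_sign_right:
  "multilinear s F \<Longrightarrow> joint_circ q F (parity_sign n Q) = parity_sign n (joint_circ q F Q)"
  by (simp add: parity_sign_def joint_circ_uminus_right)

section \<open>The associator and its graded symmetry\<close>

lemma contract_joint_circ: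
  "contract X (joint_circ q F Q) =
    contract (fst X, Q [] (Inl (snd X))) F + contract (Q [] (Inl (fst X)), snd X) F +
    joint_circ (Suc q) F (contract X Q) + parity_sign q (joint_circ q (contract X F) Q)"
  by (simp add: contract_def fun_eq_iff parity_sign_apply)

text \<open>This is what remains of homogeneity when a degree is known only by its parity. At
  \<open>Xs = []\<close> it says that a cochain acting nontrivially on a single vector has even
  degree, which removes the terms whose signs would disagree.\<close>

definition odd_part_vanishes :: "nat \<Rightarrow> 'v::zero joint_cochain \<Rightarrow> bool" where
  "odd_part_vanishes p P \<longleftrightarrow> (\<forall>Xs x. odd (length Xs + p) \<longrightarrow> P Xs (Inl x) = 0)"

lemma odd_part_vanishes_contract:
  "odd_part_vanishes p P \<Longrightarrow> odd_part_vanishes (Suc p) (contract X P)"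
  by (simp add: odd_part_vanishes_def contract_def)

lemma joint_circ_degree_cong:
  assumes "even m = even n"
  shows "joint_circ m F Q = joint_circ n F Q"
proof -
  have "joint_circ m F Q Xs e = joint_circ n F Q Xs e" for Xs e
    using assms
    by (induction m F Q Xs e arbitrary: n rule: joint_circ.induct)
      (simp_all add: parity_sign_def)
  then show ?thesis by (simp add: fun_eq_iff)
qed

lemma multilinear_contract_zero:
  "multilinear s F \<Longrightarrow> contract (a, 0) F = 0" "multilinear s F \<Longrightarrow> contract (0, a) F = 0"
  by (simp_all add: contract_def fun_eq_iff multilinear_zero_args)

text \<open>Expand both products along the first pair. The terms where \<open>P []\<close> is
  applied to a value of \<open>Q []\<close> cancel, and so do those where the pair changed by
  \<open>Q\<close> is contracted with \<open>P\<close>. There remain one associator for each cochain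
  that can take the pair (\<open>Q\<close>, \<open>P\<close>, \<open>F\<close>, with the sign for
  moving the pair past the cochains behind it), the two terms where \<open>P\<close> and
  \<open>Q\<close> act on different halves of the pair, and compositions into \<open>F\<close>
  contracted with a pair on which only \<open>Q\<close> or only \<open>P\<close> has acted.\<close>

lemma joint_circ_associator_Cons:
  assumes F: "multilinear s F" and P: "multilinear s P" and Q: "odd_part_vanishes q Q"
  shows "joint_circ q (joint_circ p F P) Q ((x, y) # Xs) e -
      joint_circ (p + q) F (joint_circ q P Q) ((x, y) # Xs) e =
    (joint_circ (Suc q) (joint_circ p F P) (contract (x, y) Q) Xs e -
      joint_circ (p + Suc q) F (joint_circ (Suc q) P (contract (x, y) Q)) Xs e) +
    parity_sign q (joint_circ q (joint_circ (Suc p) F (contract (x, y) P)) Q Xs e -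
      joint_circ (Suc p + q) F (joint_circ q (contract (x, y) P) Q) Xs e) +
    parity_sign (p + q) (joint_circ q (joint_circ p (contract (x, y) F) P) Q Xs e -
      joint_circ (p + q) (contract (x, y) F) (joint_circ q P Q) Xs e) +
    (F ((P [] (Inl x), Q [] (Inl y)) # Xs) e + F ((Q [] (Inl x), P [] (Inl y)) # Xs) e) +
    parity_sign p (joint_circ p (contract (x, Q [] (Inl y)) F) P Xs e +
      joint_circ p (contract (Q [] (Inl x), y) F) P Xs e) +
    parity_sign q (joint_circ q (contract (x, P [] (Inl y)) F) Q Xs e +
      joint_circ q (contract (P [] (Inl x), y) F) Q Xs e)"
proof -
  \<comment> \<open>The two products yield these terms with parities \<open>p + q + 1\<close> and
    \<open>p + 1\<close>. A nonzero \<open>Q [] (Inl b)\<close> forces \<open>q\<close> to be even;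
    if it is zero, so is the contraction of \<open>P\<close>.\<close>
  have deg: "joint_circ (Suc (p + q)) F (contract (a, Q [] (Inl b)) P) =
        joint_circ (Suc p) F (contract (a, Q [] (Inl b)) P)"
      "joint_circ (Suc (p + q)) F (contract (Q [] (Inl b), a) P) =
        joint_circ (Suc p) F (contract (Q [] (Inl b), a) P)" for a b
  proof -
    have "Q [] (Inl b) = 0 \<or> even q"
      using Q by (auto simp: odd_part_vanishes_def)
    then show "joint_circ (Suc (p + q)) F (contract (a, Q [] (Inl b)) P) =
        joint_circ (Suc p) F (contract (a, Q [] (Inl b)) P)"
      "joint_circ (Suc (p + q)) F (contract (Q [] (Inl b), a) P) =
        joint_circ (Suc p) F (contract (Q [] (Inl b), a) P)"
      using joint_circ_degree_cong[of "Suc (p + q)" "Suc p" F]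
      by (auto simp: multilinear_contract_zero[OF P] joint_circ_zero_right[OF F])
  qed
  have L: "joint_circ q (joint_circ p F P) Q ((x, y) # Xs) e =
    (F ((x, P [] (Inl (Q [] (Inl y)))) # Xs) e + F ((P [] (Inl x), Q [] (Inl y)) # Xs) e +
      joint_circ (Suc p) F (contract (x, Q [] (Inl y)) P) Xs e +
      parity_sign p (joint_circ p (contract (x, Q [] (Inl y)) F) P Xs e)) +
    (F ((Q [] (Inl x), P [] (Inl y)) # Xs) e + F ((P [] (Inl (Q [] (Inl x))), y) # Xs) e +
      joint_circ (Suc p) F (contract (Q [] (Inl x), y) P) Xs e +
      parity_sign p (joint_circ p (contract (Q [] (Inl x), y) F) P Xs e)) +
    joint_circ (Suc q) (joint_circ p F P) (contract (x, y) Q) Xs e +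
    parity_sign q (joint_circ q (contract (x, P [] (Inl y)) F) Q Xs e +
      joint_circ q (contract (P [] (Inl x), y) F) Q Xs e +
      joint_circ q (joint_circ (Suc p) F (contract (x, y) P)) Q Xs e +
      parity_sign p (joint_circ q (joint_circ p (contract (x, y) F) P) Q Xs e))"
    unfolding joint_circ.simps(3) contract_joint_circ joint_circ_add_left
      joint_circ_parity_sign_left by (simp add: parity_sign_apply)
  have R: "joint_circ (p + q) F (joint_circ q P Q) ((x, y) # Xs) e =
    F ((x, P [] (Inl (Q [] (Inl y)))) # Xs) e + F ((P [] (Inl (Q [] (Inl x))), y) # Xs) e +
    (joint_circ (Suc p) F (contract (x, Q [] (Inl y)) P) Xs e +
      joint_circ (Suc p) F (contract (Q [] (Inl x), y) P) Xs e +
      joint_circ (p + Suc q) F (joint_circ (Suc q) P (contract (x, y) Q)) Xs e +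
      parity_sign q (joint_circ (Suc p + q) F (joint_circ q (contract (x, y) P) Q) Xs e)) +
    parity_sign (p + q) (joint_circ (p + q) (contract (x, y) F) (joint_circ q P Q) Xs e)"
    unfolding joint_circ.simps(3) contract_joint_circ joint_circ_add_right[OF F]
      joint_circ_parity_sign_right[OF F] fst_conv snd_conv deg
    by (simp add: parity_sign_apply)
  show ?thesis
    unfolding L R by (cases "even p"; cases "even q") (simp_all add: parity_sign_def algebra_simps)
qed

text \<open>The sign bookkeeping of the induction step. Exchanging the two cochains turns the
  associator with the second one contracted into that with the first one contracted, hence the
  crossed indices of \<open>A1\<close>, \<open>A2\<close> and \<open>B1\<close>, \<open>B2\<close>.
  \<open>D\<close> and \<open>E\<close> keep their signs because each survives only when
  \<open>p * q\<close> is even.\<close>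

lemma parity_sign_combine:
  assumes "A1 = parity_sign (p * Suc q) B2" "A2 = parity_sign (Suc p * q) B1"
    "A3 = parity_sign (p * q) B3" "C = parity_sign (p * q) C'"
    "odd q \<Longrightarrow> D = 0" "odd p \<Longrightarrow> E = 0"
  shows "A1 + parity_sign q A2 + parity_sign (p + q) A3 + C + parity_sign p D + parity_sign q E =
    parity_sign (p * q)
      (B1 + parity_sign p B2 + parity_sign (q + p) B3 + C' + parity_sign q E + parity_sign p D)"
  using assms by (cases "even p"; cases "even q") (simp_all add: parity_sign_def algebra_simps)

text \<open>All three cochains and both degrees are generalised in the induction, since the
  hypothesis is applied with \<open>Q\<close>, \<open>P\<close> and \<open>F\<close> contracted in
  turn.\<close>

lemma joint_circ_pre_lie:
  assumes "multilinear s F" "multilinear s P" "multilinear s Q"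
    "odd_part_vanishes p P" "odd_part_vanishes q Q"
  shows "joint_circ q (joint_circ p F P) Q Xs e - joint_circ (p + q) F (joint_circ q P Q) Xs e =
    parity_sign (p * q)
      (joint_circ p (joint_circ q F Q) P Xs e - joint_circ (q + p) F (joint_circ p Q P) Xs e)"
  using assms
proof (induction Xs arbitrary: F P Q p q)
  case Nil
  have P0: "P [] (Inl x) = 0" if "odd p" for x
    using Nil(4) that by (auto simp: odd_part_vanishes_def)
  have Q0: "Q [] (Inl x) = 0" if "odd q" for x
    using Nil(5) that by (auto simp: odd_part_vanishes_def)
  note F = multilinear_add_args[OF Nil(1)] multilinear_zero_args[OF Nil(1)]
    multilinear_zero_args[OF Nil(2)] multilinear_zero_args[OF Nil(3)]
  show ?case
  proof (cases e)
    case (Inl x)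
    then show ?thesis by (simp add: parity_sign_def)
  next
    case (Inr X)
    obtain x y where "X = (x, y)" by force
    \<comment> \<open>The nested terms cancel. Writing \<open>P x\<close> for
      \<open>P [] (Inl x)\<close>, what remains is
      \<open>F [] (Inr (P x, Q y)) + F [] (Inr (Q x, P y))\<close>, symmetric in \<open>P\<close>
      and \<open>Q\<close>, and zero if \<open>p\<close> or \<open>q\<close> is odd.\<close>
    with Inr show ?thesis
      using P0 Q0 by (cases "odd p"; cases "odd q") (simp_all add: parity_sign_def F algebra_simps)
  qed
next
  case (Cons X Xs)
  obtain x y where X: "X = (x, y)" by force
  have P0: "P [] (Inl x) = 0" if "odd p" for x
    using Cons.prems(4) that by (auto simp: odd_part_vanishes_def)
  have Q0: "Q [] (Inl x) = 0" if "odd q" for x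
    using Cons.prems(5) that by (auto simp: odd_part_vanishes_def)
  note F0 = multilinear_zero_args[OF Cons.prems(1)] multilinear_contract_zero[OF Cons.prems(1)]
  show ?case
    unfolding X joint_circ_associator_Cons[OF Cons.prems(1,2,5)]
      joint_circ_associator_Cons[OF Cons.prems(1,3,4)]
  proof (rule parity_sign_combine)
    show "F ((P [] (Inl x), Q [] (Inl y)) # Xs) e + F ((Q [] (Inl x), P [] (Inl y)) # Xs) e =
      parity_sign (p * q)
        (F ((Q [] (Inl x), P [] (Inl y)) # Xs) e + F ((P [] (Inl x), Q [] (Inl y)) # Xs) e)"
      using P0 by (cases "odd p") (simp_all add: F0 parity_sign_def add_ac)
    show "odd q \<Longrightarrow> joint_circ p (contract (x, Q [] (Inl y)) F) P Xs e +
        joint_circ p (contract (Q [] (Inl x), y) F) P Xs e = 0"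
      by (simp add: Q0 F0 joint_circ_zero_left)
    show "odd p \<Longrightarrow> joint_circ q (contract (x, P [] (Inl y)) F) Q Xs e +
        joint_circ q (contract (P [] (Inl x), y) F) Q Xs e = 0"
      by (simp add: P0 F0 joint_circ_zero_left)
  \<comment> \<open>The three associators on the tail have degrees \<open>(p, Suc q)\<close>,
    \<open>(Suc p, q)\<close> and \<open>(p, q)\<close>, for \<open>Q\<close>, \<open>P\<close> and
    \<open>F\<close> contracted.\<close>
  qed (rule Cons.IH; simp add: Cons.prems multilinear_contract odd_part_vanishes_contract)+
qed

section \<open>Multilinearity of the composition\<close>

context vector_space
begin

lemma linear_mapI:
  "(\<And>a b. f (a + b) = f a + f b) \<Longrightarrow> (\<And>c a. f (scale c a) = scale c (f a)) \<Longrightarrow>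
    Vector_Spaces.linear scale scale f"
  by (intro_locales; unfold_locales) (simp_all add: module_axioms)

lemma linear_map_compose:
  "Vector_Spaces.linear scale scale f \<Longrightarrow> Vector_Spaces.linear scale scale g \<Longrightarrow>
    Vector_Spaces.linear scale scale (\<lambda>x. f (g x))"
  by (rule linear_mapI) (simp_all add: linear_mapD)

lemma linear_map_sum:
  "Vector_Spaces.linear scale scale f \<Longrightarrow> Vector_Spaces.linear scale scale g \<Longrightarrow>
    Vector_Spaces.linear scale scale (\<lambda>x. f x + g x)"
  by (rule linear_mapI) (simp_all add: linear_mapD scale_right_distrib add_ac)

lemma linear_map_parity_sign:
  "Vector_Spaces.linear scale scale f \<Longrightarrow>
    Vector_Spaces.linear scale scale (\<lambda>x. parity_sign n (f x))"
  by (rule linear_mapI) (simp_all add: linear_mapD parity_sign_def)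

lemma alternating_bilinearI:
  assumes "\<And>y. Vector_Spaces.linear scale scale (\<lambda>x. f x y)"
    "\<And>x. Vector_Spaces.linear scale scale (f x)" "\<And>x. f x x = 0"
  shows "alternating_bilinear scale f"
  using assms by (simp add: alternating_bilinear_def)

lemma alternating_bilinearD:
  assumes "alternating_bilinear scale f"
  shows "Vector_Spaces.linear scale scale (\<lambda>x. f x y)"
    "Vector_Spaces.linear scale scale (f x)" "f x x = 0"
  using assms by (simp_all add: alternating_bilinear_def)

lemma alternating_bilinear_add:
  "alternating_bilinear scale f \<Longrightarrow> alternating_bilinear scale g \<Longrightarrow>
    alternating_bilinear scale (\<lambda>x y. f x y + g x y)"
  by (intro alternating_bilinearI linear_map_sum) (simp_all add: alternating_bilinearD)

lemma alternating_bilinear_parity_sign: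
  "alternating_bilinear scale f \<Longrightarrow> alternating_bilinear scale (\<lambda>x y. parity_sign n (f x y))"
  by (intro alternating_bilinearI linear_map_parity_sign)
    (simp_all add: alternating_bilinearD parity_sign_def)

lemma alternating_bilinear_compose:
  "Vector_Spaces.linear scale scale g \<Longrightarrow> alternating_bilinear scale f \<Longrightarrow>
    alternating_bilinear scale (\<lambda>x y. g (f x y))"
  by (rule alternating_bilinearI)
    (simp_all add: linear_map_compose[of g, OF _ alternating_bilinearD(1)]
      linear_map_compose[of g, OF _ alternating_bilinearD(2)] alternating_bilinearD linear_map_zero)

text \<open>Neither summand need be alternating; at \<open>x = y\<close> the sum is
  \<open>f x (g x) + f (g x) x\<close>, which vanishes by skew symmetry.\<close>

lemma alternating_bilinear_derivation:
  assumes f: "alternating_bilinear scale f" and g: "Vector_Spaces.linear scale scale g"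
  shows "alternating_bilinear scale (\<lambda>x y. f x (g y) + f (g x) y)"
proof (rule alternating_bilinearI)
  show "Vector_Spaces.linear scale scale (\<lambda>x. f x (g y) + f (g x) y)" for y
    by (intro linear_map_sum linear_map_compose[OF _ g] alternating_bilinearD(1)[OF f])
  show "Vector_Spaces.linear scale scale (\<lambda>y. f x (g y) + f (g x) y)" for x
    by (intro linear_map_sum linear_map_compose[OF _ g] alternating_bilinearD(2)[OF f])
  show "f x (g x) + f (g x) x = 0" for x
    by (rule alternating_bilinear_skew[OF f])
qed

lemma multilinearD:
  assumes "multilinear scale F"
  shows "alternating_bilinear scale (\<lambda>a b. F (As @ (a, b) # Bs) e)"
    "alternating_bilinear scale (\<lambda>a b. F ((a, b) # Bs) e)"
    "Vector_Spaces.linear scale scale (\<lambda>x. F As (Inl x))"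
    "alternating_bilinear scale (\<lambda>a b. F As (Inr (a, b)))"
proof -
  show "alternating_bilinear scale (\<lambda>a b. F ((a, b) # Bs) e)"
    by (rule multilinear_head[OF assms])
qed (use assms in \<open>simp_all add: multilinear_def\<close>)

lemma multilinear_scale_args:
  assumes "multilinear scale F"
  shows "F ((scale c a, b) # Bs) e = scale c (F ((a, b) # Bs) e)"
    "F ((b, scale c a) # Bs) e = scale c (F ((b, a) # Bs) e)"
    "F As (Inl (scale c a)) = scale c (F As (Inl a))"
    "F As (Inr (scale c a, b)) = scale c (F As (Inr (a, b)))"
    "F As (Inr (b, scale c a)) = scale c (F As (Inr (b, a)))"
  using linear_mapD(2)[OF alternating_bilinearD(1)[OF multilinearD(2)[OF assms]]]
    linear_mapD(2)[OF alternating_bilinearD(2)[OF multilinearD(2)[OF assms]]]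
    linear_mapD(2)[OF multilinearD(3)[OF assms]]
    linear_mapD(2)[OF alternating_bilinearD(1)[OF multilinearD(4)[OF assms]]]
    linear_mapD(2)[OF alternating_bilinearD(2)[OF multilinearD(4)[OF assms]]]
  by this+

lemma contract_scale: "contract X (\<lambda>Ys e. scale c (F Ys e)) = (\<lambda>Ys e. scale c (contract X F Ys e))"
  by (simp add: contract_def)

lemma parity_sign_scale: "parity_sign n (scale c v) = scale c (parity_sign n v)"
  by (simp add: parity_sign_def)

lemma joint_circ_scale_left:
  "joint_circ q (\<lambda>Ys e. scale c (F Ys e)) Q = (\<lambda>Ys e. scale c (joint_circ q F Q Ys e))"
proof -
  have "joint_circ q (\<lambda>Ys e. scale c (F Ys e)) Q Xs e = scale c (joint_circ q F Q Xs e)" for Xs e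
    by (induction q F Q Xs e rule: joint_circ.induct)
      (simp_all add: contract_scale parity_sign_scale scale_right_distrib)
  then show ?thesis by (simp add: fun_eq_iff)
qed

lemma joint_circ_scale_right:
  assumes "multilinear scale F"
  shows "joint_circ q F (\<lambda>Ys e. scale c (Q Ys e)) = (\<lambda>Ys e. scale c (joint_circ q F Q Ys e))"
proof -
  have "joint_circ q F (\<lambda>Ys e. scale c (Q Ys e)) Xs e = scale c (joint_circ q F Q Xs e)" for Xs e
    using assms
    by (induction q F Q Xs e rule: joint_circ.induct)
      (simp_all add: contract_scale parity_sign_scale scale_right_distrib multilinear_scale_args
        multilinear_contract)
  then show ?thesis by (simp add: fun_eq_iff)
qed

text \<open>The parameter \<open>a\<close> stands for one half of a pair contracted into
  \<open>F\<close>; stated for families, linearity in that pair passes through the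
  recursion.\<close>

lemma linear_joint_circ_left:
  assumes "\<And>Xs e. Vector_Spaces.linear scale scale (\<lambda>a. F a Xs e)"
  shows "Vector_Spaces.linear scale scale (\<lambda>a. joint_circ q (F a) Q Xs e)"
proof (rule linear_mapI)
  have "F (a + b) = F a + F b" for a b
    by (simp add: fun_eq_iff linear_mapD[OF assms])
  then show "joint_circ q (F (a + b)) Q Xs e = joint_circ q (F a) Q Xs e + joint_circ q (F b) Q Xs e"
    for a b
    by (simp only: joint_circ_add_left plus_fun_apply)
  have "F (scale c a) = (\<lambda>Ys e. scale c (F a Ys e))" for a c
    by (simp add: fun_eq_iff linear_mapD[OF assms])
  then show "joint_circ q (F (scale c a)) Q Xs e = scale c (joint_circ q (F a) Q Xs e)" for a c
    by (simp only: joint_circ_scale_left)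
qed

lemma linear_joint_circ_right:
  assumes F: "multilinear scale F" and Q: "\<And>Xs e. Vector_Spaces.linear scale scale (\<lambda>a. Q a Xs e)"
  shows "Vector_Spaces.linear scale scale (\<lambda>a. joint_circ q F (Q a) Xs e)"
proof (rule linear_mapI)
  have "Q (a + b) = Q a + Q b" for a b
    by (simp add: fun_eq_iff linear_mapD[OF Q])
  then show "joint_circ q F (Q (a + b)) Xs e = joint_circ q F (Q a) Xs e + joint_circ q F (Q b) Xs e"
    for a b
    by (simp only: joint_circ_add_right[OF F] plus_fun_apply)
  have "Q (scale c a) = (\<lambda>Ys e. scale c (Q a Ys e))" for a c
    by (simp add: fun_eq_iff linear_mapD[OF Q])
  then show "joint_circ q F (Q (scale c a)) Xs e = scale c (joint_circ q F (Q a) Xs e)" for a c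
    by (simp only: joint_circ_scale_right[OF F])
qed

lemma alternating_bilinear_joint_circ_left:
  assumes "\<And>Xs e. alternating_bilinear scale (\<lambda>a b. F a b Xs e)"
  shows "alternating_bilinear scale (\<lambda>a b. joint_circ q (F a b) Q Xs e)"
proof (rule alternating_bilinearI)
  have "F a a = 0" for a
    using assms by (simp add: fun_eq_iff alternating_bilinear_def)
  then show "joint_circ q (F a a) Q Xs e = 0" for a
    by (simp add: joint_circ_zero_left)
qed (rule linear_joint_circ_left alternating_bilinearD[OF assms])+

lemma alternating_bilinear_joint_circ_right:
  assumes F: "multilinear scale F" and Q: "\<And>Xs e. alternating_bilinear scale (\<lambda>a b. Q a b Xs e)"
  shows "alternating_bilinear scale (\<lambda>a b. joint_circ q F (Q a b) Xs e)"
proof (rule alternating_bilinearI)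
  have "Q a a = 0" for a
    using Q by (simp add: fun_eq_iff alternating_bilinear_def)
  then show "joint_circ q F (Q a a) Xs e = 0" for a
    by (simp add: joint_circ_zero_right[OF F])
qed (rule linear_joint_circ_right[OF F] alternating_bilinearD[OF Q])+

lemma alternating_bilinear_contract:
  "multilinear scale F \<Longrightarrow> alternating_bilinear scale (\<lambda>a b. contract (a, b) F Xs e)"
  by (simp add: contract_def multilinearD)

lemma joint_circ_linear_Inl:
  assumes "multilinear scale F" "multilinear scale Q"
  shows "Vector_Spaces.linear scale scale (\<lambda>x. joint_circ q F Q As (Inl x))"
  using assms
proof (induction As arbitrary: q F Q)
  case Nil
  show ?case
    unfolding joint_circ.simps(1)
    by (rule linear_map_compose[of "\<lambda>x. F [] (Inl x)"]) (rule multilinearD Nil)+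
next
  case (Cons X As)
  have "Vector_Spaces.linear scale scale (\<lambda>x. F (Y # As) (Inl x))" for Y
    using multilinearD(3)[OF Cons.prems(1)] .
  then show ?case
    unfolding joint_circ.simps(3)
    by (intro linear_map_sum linear_map_parity_sign Cons.IH multilinear_contract Cons.prems)
qed

lemma joint_circ_alternating_Inr:
  assumes "multilinear scale F" "multilinear scale Q"
  shows "alternating_bilinear scale (\<lambda>a b. joint_circ q F Q As (Inr (a, b)))"
  using assms
proof (induction As arbitrary: q F Q)
  case Nil
  then show ?case
    unfolding joint_circ.simps(2) add.assoc
    by (intro alternating_bilinear_add alternating_bilinear_compose[of "\<lambda>x. F [] (Inl x)"]
        alternating_bilinear_derivation multilinearD)
next
  case (Cons X As)
  have "alternating_bilinear scale (\<lambda>a b. F (Y # As) (Inr (a, b)))" for Y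
    using multilinearD(4)[OF Cons.prems(1)] .
  then show ?case
    unfolding joint_circ.simps(3)
    by (intro alternating_bilinear_add alternating_bilinear_parity_sign Cons.IH
        multilinear_contract Cons.prems)
qed

text \<open>A pair behind the head is covered by the induction hypothesis. At the head the recursion
  consumes it, and it reappears in the two insertions taken together, in the contraction of
  \<open>Q\<close> and in the contraction of \<open>F\<close>, each of which is alternating.\<close>

lemma joint_circ_alternating_entry:
  assumes "multilinear scale F" "multilinear scale Q"
  shows "alternating_bilinear scale (\<lambda>a b. joint_circ q F Q (As @ (a, b) # Bs) e)"
  using assms
proof (induction As arbitrary: q F Q)
  case Nil
  then show ?case
    unfolding append_Nil joint_circ.simps(3) fst_conv snd_conv
    by (intro alternating_bilinear_add alternating_bilinear_parity_sign
        alternating_bilinear_derivation[of "\<lambda>a b. F ((a, b) # Bs) e"]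
        alternating_bilinear_joint_circ_left alternating_bilinear_joint_circ_right
        alternating_bilinear_contract multilinearD)
next
  case (Cons X As)
  have "alternating_bilinear scale (\<lambda>a b. F (Y # As @ (a, b) # Bs) e)" for Y
    using multilinearD(1)[OF Cons.prems(1), of "Y # As"] by simp
  then show ?case
    unfolding append_Cons joint_circ.simps(3)
    by (intro alternating_bilinear_add alternating_bilinear_parity_sign Cons.IH
        multilinear_contract Cons.prems)
qed

lemma multilinear_joint_circ:
  "multilinear scale F \<Longrightarrow> multilinear scale Q \<Longrightarrow> multilinear scale (joint_circ q F Q)"
  unfolding multilinear_def[of scale "joint_circ q F Q"]
  by (intro conjI allI joint_circ_linear_Inl joint_circ_alternating_Inr
      joint_circ_alternating_entry)

end

section \<open>Shuffles\<close>

text \<open>The cycle that sends \<open>i\<close> to \<open>i + j\<close> and lowers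
  \<open>i + 1, ..., i + j\<close> by one, built from adjacent transpositions so that its sign is
  visible. It serves to move one place past a block of length \<open>j\<close>.\<close>

primrec back_cycle :: "nat \<Rightarrow> nat \<Rightarrow> nat \<Rightarrow> nat" where
  "back_cycle i 0 = id"
| "back_cycle i (Suc j) = transpose (i + j) (Suc (i + j)) \<circ> back_cycle i j"

lemma back_cycle_apply:
  "back_cycle i j m = (if m = i then i + j else if i < m \<and> m \<le> i + j then m - 1 else m)"
  by (induction j arbitrary: m) (auto simp: transpose_def)

lemma back_cycle_permutes: "back_cycle i j permutes {i..i + j}"
proof (induction j)
  case (Suc j)
  have "back_cycle i j permutes {i..i + Suc j}"
    by (rule permutes_subset[OF Suc]) auto
  then show ?case
    unfolding back_cycle.simps by (rule permutes_compose) (rule permutes_swap_id; simp)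
qed (simp only: back_cycle.simps permutes_id)

lemma sign_back_cycle: "sign (back_cycle i j) = (-1) ^ j"
proof (induction j)
  case (Suc j)
  have "permutation (back_cycle i j)"
    by (rule permutes_imp_permutation[OF _ back_cycle_permutes]) simp
  then show ?case
    unfolding back_cycle.simps sign_compose[OF permutation_swap_id \<open>permutation _\<close>] Suc
    by (simp add: sign_swap_id)
qed (simp only: back_cycle.simps sign_id power_0)

lemma finite_shuffle_perms: "finite (shuffle_perms i j)"
  by (rule finite_subset[OF _ finite_permutations[of "{1..i + j}"]]) (auto simp: shuffle_perms_def)

lemma shuffle_perms_permutation: "\<sigma> \<in> shuffle_perms i j \<Longrightarrow> permutation \<sigma>"
  by (auto simp: shuffle_perms_def intro: permutes_imp_permutation[of "{1..i + j}"])

lemma shuffle_perms_range: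
  "\<sigma> \<in> shuffle_perms i j \<Longrightarrow> m \<in> {1..i + j} \<Longrightarrow> \<sigma> m \<in> {1..i + j}"
  using permutes_in_image[of \<sigma> "{1..i + j}" m] by (simp add: shuffle_perms_def)

text \<open>A strictly increasing permutation of an initial segment dominates the identity, hence
  equals it.\<close>

lemma shuffle_perms_0_right: "shuffle_perms i 0 = {id}"
proof -
  have "\<sigma> = id" if "\<sigma> permutes {1..i}" "strict_mono_on {1..i} \<sigma>" for \<sigma>
  proof (rule permutes_natset_ge[OF that(1)], rule ballI)
    fix m assume "m \<in> {1..i}"
    then show "m \<le> \<sigma> m"
    proof (induction m)
      case (Suc m)
      show ?case
      proof (cases "m = 0")
        case True
        then show ?thesis
          using permutes_in_image[OF that(1), of 1] Suc.prems by auto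
      next
        case False
        then have "\<sigma> m < \<sigma> (Suc m)"
          using Suc.prems by (intro strict_mono_onD[OF that(2)]) auto
        then show ?thesis using Suc False by simp
      qed
    qed simp
  qed
  then show ?thesis
    by (auto simp: shuffle_perms_def permutes_id strict_mono_on_def)
qed

lemma shuffle_perms_0_left: "shuffle_perms 0 j = {id}"
proof -
  have "shuffle_perms 0 j = shuffle_perms j 0"
    by (simp add: shuffle_perms_def)
  then show ?thesis by (simp add: shuffle_perms_0_right)
qed

text \<open>Permutations here are functions on all natural numbers that fix everything outside their
  set, so forgetting a fixed last point changes neither the function nor its sign. This also absorbs
  the side condition on \<sigma> in the formula for the first component.\<close>

lemma shuffle_perms_last_fixed:
  "{\<sigma> \<in> shuffle_perms i (Suc j). \<sigma> (i + Suc j) = i + Suc j} = shuffle_perms i j"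
proof (intro set_eqI iffI)
  fix \<sigma> assume "\<sigma> \<in> {\<sigma> \<in> shuffle_perms i (Suc j). \<sigma> (i + Suc j) = i + Suc j}"
  then have \<sigma>: "\<sigma> permutes {1..i + Suc j}" "strict_mono_on {1..i} \<sigma>"
    "strict_mono_on {i + 1..i + Suc j} \<sigma>" "\<sigma> (i + Suc j) = i + Suc j"
    by (auto simp: shuffle_perms_def)
  have "\<sigma> permutes {1..i + j}"
    by (rule permutes_superset[OF \<sigma>(1)]) (use \<sigma>(4) in \<open>auto simp: le_Suc_eq\<close>)
  then show "\<sigma> \<in> shuffle_perms i j"
    using \<sigma> by (auto simp: shuffle_perms_def intro: monotone_on_subset)
next
  fix \<sigma> assume "\<sigma> \<in> shuffle_perms i j"
  then have \<sigma>: "\<sigma> permutes {1..i + j}" "strict_mono_on {1..i} \<sigma>"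
    "strict_mono_on {i + 1..i + j} \<sigma>"
    by (auto simp: shuffle_perms_def)
  have last: "\<sigma> (i + Suc j) = i + Suc j"
    by (rule permutes_not_in[OF \<sigma>(1)]) simp
  have "strict_mono_on {i + 1..i + Suc j} \<sigma>"
  proof (rule strict_mono_onI)
    fix a b assume ab: "a \<in> {i + 1..i + Suc j}" "b \<in> {i + 1..i + Suc j}" "a < b"
    show "\<sigma> a < \<sigma> b"
    proof (cases "b = i + Suc j")
      case True
      have "\<sigma> a \<in> {1..i + j}"
        using permutes_in_image[OF \<sigma>(1), of a] ab by auto
      then show ?thesis using True last by simp
    next
      case False
      then show ?thesis using ab by (intro strict_mono_onD[OF \<sigma>(3)]) auto
    qed
  qed
  moreover have "\<sigma> permutes {1..i + Suc j}"
    by (rule permutes_subset[OF \<sigma>(1)]) auto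
  ultimately show "\<sigma> \<in> {\<sigma> \<in> shuffle_perms i (Suc j). \<sigma> (i + Suc j) = i + Suc j}"
    using \<sigma> last by (simp add: shuffle_perms_def)
qed

text \<open>Dropping the place \<open>Suc i\<close> moves every place of the second block down by
  one; precomposition with the cycle does this renumbering, and its sign \<open>(-1) ^ j\<close>
  counts the places passed.\<close>

lemma shuffle_perms_last_in_first_block:
  "bij_betw (\<lambda>\<tau>. \<tau> \<circ> back_cycle (Suc i) j) (shuffle_perms i j)
    {\<sigma> \<in> shuffle_perms (Suc i) j. \<sigma> (Suc i) = Suc i + j}"
proof -
  let ?c = "back_cycle (Suc i) j"
  have c: "?c permutes {1..Suc i + j}"
    by (rule permutes_subset[OF back_cycle_permutes]) auto
  have inv_c: "inv ?c permutes {1..Suc i + j}"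
    by (rule permutes_inv[OF c])
  have inv_low: "inv ?c m = m" if "m \<le> i" for m
    by (subst permutes_inv_eq[OF c]) (use that in \<open>auto simp: back_cycle_apply\<close>)
  have inv_mid: "inv ?c m = Suc m" if "i < m" "m \<le> i + j" for m
    by (subst permutes_inv_eq[OF c]) (use that in \<open>auto simp: back_cycle_apply\<close>)
  have inv_last: "inv ?c (Suc i + j) = Suc i"
    by (subst permutes_inv_eq[OF c]) (auto simp: back_cycle_apply)
  show ?thesis
  proof (rule bij_betw_byWitness[where f' = "\<lambda>\<sigma>. \<sigma> \<circ> inv ?c"])
    show "\<forall>\<tau>\<in>shuffle_perms i j. (\<tau> \<circ> ?c) \<circ> inv ?c = \<tau>"
      by (simp add: o_assoc[symmetric] permutes_inv_o(1)[OF c])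
    show "\<forall>\<sigma>\<in>{\<sigma> \<in> shuffle_perms (Suc i) j. \<sigma> (Suc i) = Suc i + j}. (\<sigma> \<circ> inv ?c) \<circ> ?c = \<sigma>"
      by (simp add: o_assoc[symmetric] permutes_inv_o(2)[OF c])
    show "(\<lambda>\<tau>. \<tau> \<circ> ?c) ` shuffle_perms i j
        \<subseteq> {\<sigma> \<in> shuffle_perms (Suc i) j. \<sigma> (Suc i) = Suc i + j}"
    proof (rule image_subsetI)
      fix \<tau> assume "\<tau> \<in> shuffle_perms i j"
      then have \<tau>: "\<tau> permutes {1..i + j}" "strict_mono_on {1..i} \<tau>"
        "strict_mono_on {i + 1..i + j} \<tau>"
        by (auto simp: shuffle_perms_def)
      have last: "\<tau> (Suc (i + j)) = Suc (i + j)"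
        by (rule permutes_not_in[OF \<tau>(1)]) simp
      have "\<tau> permutes {1..Suc i + j}"
        by (rule permutes_subset[OF \<tau>(1)]) auto
      then have "\<tau> \<circ> ?c permutes {1..Suc i + j}"
        by (rule permutes_compose[OF c])
      moreover have "strict_mono_on {1..Suc i} (\<tau> \<circ> ?c)"
      proof (rule strict_mono_onI)
        fix a b assume ab: "a \<in> {1..Suc i}" "b \<in> {1..Suc i}" "a < b"
        show "(\<tau> \<circ> ?c) a < (\<tau> \<circ> ?c) b"
        proof (cases "b = Suc i")
          case True
          have "\<tau> a \<in> {1..i + j}"
            using permutes_in_image[OF \<tau>(1), of a] ab by auto
          then show ?thesis using True last ab by (simp add: back_cycle_apply)
        next
          case False
          then have "\<tau> a < \<tau> b"
            using ab by (intro strict_mono_onD[OF \<tau>(2)]) auto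
          then show ?thesis using False ab by (simp add: back_cycle_apply)
        qed
      qed
      moreover have "strict_mono_on {Suc i + 1..Suc i + j} (\<tau> \<circ> ?c)"
      proof (rule strict_mono_onI)
        fix a b assume ab: "a \<in> {Suc i + 1..Suc i + j}" "b \<in> {Suc i + 1..Suc i + j}" "a < b"
        then have "\<tau> (a - 1) < \<tau> (b - 1)"
          by (intro strict_mono_onD[OF \<tau>(3)]) auto
        then show "(\<tau> \<circ> ?c) a < (\<tau> \<circ> ?c) b"
          using ab by (simp add: back_cycle_apply)
      qed
      ultimately show "\<tau> \<circ> ?c \<in> {\<sigma> \<in> shuffle_perms (Suc i) j. \<sigma> (Suc i) = Suc i + j}"
        using last by (simp add: shuffle_perms_def back_cycle_apply)
    qed
    show "(\<lambda>\<sigma>. \<sigma> \<circ> inv ?c) ` {\<sigma> \<in> shuffle_perms (Suc i) j. \<sigma> (Suc i) = Suc i + j}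
        \<subseteq> shuffle_perms i j"
    proof (rule image_subsetI)
      fix \<sigma> assume "\<sigma> \<in> {\<sigma> \<in> shuffle_perms (Suc i) j. \<sigma> (Suc i) = Suc i + j}"
      then have \<sigma>: "\<sigma> permutes {1..Suc i + j}" "strict_mono_on {1..Suc i} \<sigma>"
        "strict_mono_on {Suc i + 1..Suc i + j} \<sigma>" "\<sigma> (Suc i) = Suc i + j"
        by (auto simp: shuffle_perms_def)
      have "\<sigma> \<circ> inv ?c permutes {1..Suc i + j}"
        by (rule permutes_compose[OF inv_c \<sigma>(1)])
      then have "\<sigma> \<circ> inv ?c permutes {1..i + j}"
      proof (rule permutes_superset)
        fix x assume "x \<in> {1..Suc i + j} - {1..i + j}"
        then have "x = Suc i + j" by auto
        then show "(\<sigma> \<circ> inv ?c) x = x" using \<sigma>(4) inv_last by simp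
      qed
      moreover have "strict_mono_on {1..i} (\<sigma> \<circ> inv ?c)"
      proof (rule strict_mono_onI)
        fix a b assume ab: "a \<in> {1..i}" "b \<in> {1..i}" "a < b"
        then have "\<sigma> a < \<sigma> b"
          by (intro strict_mono_onD[OF \<sigma>(2)]) auto
        then show "(\<sigma> \<circ> inv ?c) a < (\<sigma> \<circ> inv ?c) b"
          using ab by (simp add: inv_low)
      qed
      moreover have "strict_mono_on {i + 1..i + j} (\<sigma> \<circ> inv ?c)"
      proof (rule strict_mono_onI)
        fix a b assume ab: "a \<in> {i + 1..i + j}" "b \<in> {i + 1..i + j}" "a < b"
        then have "\<sigma> (Suc a) < \<sigma> (Suc b)"
          by (intro strict_mono_onD[OF \<sigma>(3)]) auto
        then show "(\<sigma> \<circ> inv ?c) a < (\<sigma> \<circ> inv ?c) b"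
          using ab by (simp add: inv_mid)
      qed
      ultimately show "\<sigma> \<circ> inv ?c \<in> shuffle_perms i j"
        by (simp add: shuffle_perms_def)
    qed
  qed
qed

text \<open>Both blocks are increasing, so the largest value can only stand at the end of one of
  them.\<close>

lemma shuffle_perms_last:
  assumes "\<sigma> \<in> shuffle_perms i j" "0 < i + j"
  shows "(0 < i \<and> \<sigma> i = i + j) \<or> (0 < j \<and> \<sigma> (i + j) = i + j)"
proof -
  have \<sigma>: "\<sigma> permutes {1..i + j}" "strict_mono_on {1..i} \<sigma>"
    "strict_mono_on {i + 1..i + j} \<sigma>"
    using assms by (auto simp: shuffle_perms_def)
  have "i + j \<in> \<sigma> ` {1..i + j}"
    unfolding permutes_image[OF \<sigma>(1)] using assms(2) by auto
  then obtain m where m: "m \<in> {1..i + j}" "\<sigma> m = i + j"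
    by (metis imageE)
  have bound: "\<sigma> k \<le> i + j" if "k \<in> {1..i + j}" for k
    using shuffle_perms_range[OF assms(1) that] by simp
  show ?thesis
  proof (cases "m \<le> i")
    case True
    have "\<not> m < i"
    proof
      assume "m < i"
      then have "\<sigma> m < \<sigma> i"
        using m by (intro strict_mono_onD[OF \<sigma>(2)]) auto
      then show False using m bound[of i] \<open>m < i\<close> by auto
    qed
    with True m show ?thesis by auto
  next
    case False
    have "\<not> m < i + j"
    proof
      assume "m < i + j"
      then have "\<sigma> m < \<sigma> (i + j)"
        using m False by (intro strict_mono_onD[OF \<sigma>(3)]) auto
      then show False using m bound[of "i + j"] \<open>m < i + j\<close> by auto
    qed
    with False m show ?thesis by auto
  qed
qed

text \<open>The signed sum of \<open>G A B\<close> over all splittings of a list into complementary sublists. If \<open>q\<close> is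
  the length of \<open>B\<close>, an entry put into \<open>A\<close> contributes the sign \<open>(-1)\<close> to the number of entries of
  \<open>B\<close> that follow it; the product is \<open>(-1)\<close> to the \<open>i * q\<close> times the sign of the \<open>(i, q)\<close>-shuffle.\<close>

fun unshuffle_sum ::
  "nat \<Rightarrow> ('a list \<Rightarrow> 'a list \<Rightarrow> 'v::ab_group_add) \<Rightarrow> 'a list \<Rightarrow> 'v" where
  "unshuffle_sum q G [] = G [] []"
| "unshuffle_sum q G (X # Xs) =
    unshuffle_sum (Suc q) (\<lambda>A B. G A (X # B)) Xs +
    parity_sign q (unshuffle_sum q (\<lambda>A B. G (X # A) B) Xs)"

lemma unshuffle_sum_add:
  "unshuffle_sum q (\<lambda>A B. G A B + H A B) Xs = unshuffle_sum q G Xs + unshuffle_sum q H Xs"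
  by (induction Xs arbitrary: q G H) (simp_all add: parity_sign_add add_ac)

lemma parity_sign_commute: "parity_sign m (parity_sign n v) = parity_sign n (parity_sign m v)"
  by (simp add: parity_sign_def)

lemma unshuffle_sum_parity_sign:
  "unshuffle_sum q (\<lambda>A B. parity_sign n (G A B)) Xs = parity_sign n (unshuffle_sum q G Xs)"
  by (induction Xs arbitrary: q G) (simp_all add: parity_sign_add parity_sign_commute)

lemma unshuffle_sum_cong:
  assumes "\<And>A B. length A + length B = length Xs \<Longrightarrow> G A B = H A B"
  shows "unshuffle_sum q G Xs = unshuffle_sum q H Xs"
  using assms
proof (induction Xs arbitrary: q G H)
  case (Cons X Xs)
  have "unshuffle_sum (Suc q) (\<lambda>A B. G A (X # B)) Xs = unshuffle_sum (Suc q) (\<lambda>A B. H A (X # B)) Xs"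
    by (rule Cons.IH) (simp add: Cons.prems)
  moreover have "unshuffle_sum q (\<lambda>A B. G (X # A) B) Xs = unshuffle_sum q (\<lambda>A B. H (X # A) B) Xs"
    by (rule Cons.IH) (simp add: Cons.prems)
  ultimately show ?case by simp
qed simp

lemma unshuffle_sum_zero:
  assumes "\<And>A B. length A + length B = length Xs \<Longrightarrow> G A B = 0"
  shows "unshuffle_sum q G Xs = 0"
proof -
  have "unshuffle_sum q (\<lambda>A B. 0) Xs = 0"
    by (induction Xs arbitrary: q) (simp_all add: parity_sign_zero)
  then show ?thesis
    using unshuffle_sum_cong[of Xs G "\<lambda>A B. 0"] assms by simp
qed

text \<open>The counter grows by one with each entry put into \<open>B\<close>, so the last entry
  meets it at \<open>q + length B\<close>. If \<open>B\<close> has \<open>q\<close> entries this is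
  even, as it should be when no entry of \<open>B\<close> follows.\<close>

lemma unshuffle_sum_snoc:
  "unshuffle_sum q G (Xs @ [X]) =
    unshuffle_sum q (\<lambda>A B. G A (B @ [X])) Xs +
    unshuffle_sum q (\<lambda>A B. parity_sign (q + length B) (G (A @ [X]) B)) Xs"
  by (induction Xs arbitrary: q G) (simp_all add: parity_sign_add add_ac)

text \<open>Each entry put into \<open>A\<close> reads the counter once, so raising the counter by
  one costs one sign for each of them.\<close>

lemma unshuffle_sum_Suc:
  "unshuffle_sum (Suc q) G Xs = unshuffle_sum q (\<lambda>A B. parity_sign (length A) (G A B)) Xs"
proof (induction Xs arbitrary: q G)
  case (Cons X Xs)
  show ?case
    by (simp add: Cons.IH unshuffle_sum_parity_sign[symmetric])
      (rule unshuffle_sum_cong, simp add: parity_sign_def)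
qed (simp add: parity_sign_def)

section \<open>Sums over shuffles as sums over splittings\<close>

definition shuffle_sum ::
  "('k::field \<Rightarrow> 'v::ab_group_add \<Rightarrow> 'v) \<Rightarrow> nat \<Rightarrow> nat \<Rightarrow>
   ('a list \<Rightarrow> 'a list \<Rightarrow> 'v) \<Rightarrow> 'a list \<Rightarrow> 'v" where
  "shuffle_sum scale i j G Xs = (\<Sum>\<sigma>\<in>shuffle_perms i j. scale (of_int (sign \<sigma>))
    (G (map (\<lambda>m. elt Xs (\<sigma> m)) [1..<i + 1]) (map (\<lambda>m. elt Xs (\<sigma> m)) [i + 1..<i + j + 1])))"

lemma elt_append_left: "0 < m \<Longrightarrow> m \<le> length Ys \<Longrightarrow> elt (Ys @ Zs) m = elt Ys m"
  by (auto simp: elt_def nth_append)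

lemma elt_last: "m = Suc (length Ys) \<Longrightarrow> elt (Ys @ [X]) m = X"
  by (simp add: elt_def)

context vector_space
begin

lemma scale_minus_one_power: "scale ((-1) ^ n) v = parity_sign n v"
  by (cases "even n") (simp_all add: parity_sign_def)

lemma shuffle_sum_last_fixed:
  assumes "length Ys = i + j"
  shows "(\<Sum>\<sigma>\<in>{\<sigma> \<in> shuffle_perms i (Suc j). \<sigma> (i + Suc j) = i + Suc j}. scale (of_int (sign \<sigma>))
    (G (map (\<lambda>m. elt (Ys @ [X]) (\<sigma> m)) [1..<i + 1])
       (map (\<lambda>m. elt (Ys @ [X]) (\<sigma> m)) [i + 1..<i + Suc j + 1]))) =
    shuffle_sum scale i j (\<lambda>A B. G A (B @ [X])) Ys"
  unfolding shuffle_sum_def shuffle_perms_last_fixed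
proof (rule sum.cong[OF refl])
  fix \<sigma> assume \<sigma>: "\<sigma> \<in> shuffle_perms i j"
  have "\<sigma> (Suc (i + j)) = Suc (i + j)"
    using \<sigma> by (auto simp: shuffle_perms_def intro: permutes_not_in)
  moreover have "elt (Ys @ [X]) (\<sigma> m) = elt Ys (\<sigma> m)" if "m \<in> {1..i + j}" for m
    using shuffle_perms_range[OF \<sigma> that] assms by (simp add: elt_append_left)
  ultimately have "map (\<lambda>m. elt (Ys @ [X]) (\<sigma> m)) [1..<i + 1] = map (\<lambda>m. elt Ys (\<sigma> m)) [1..<i + 1]"
    "map (\<lambda>m. elt (Ys @ [X]) (\<sigma> m)) [i + 1..<i + Suc j + 1] =
      map (\<lambda>m. elt Ys (\<sigma> m)) [i + 1..<i + j + 1] @ [X]"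
    using assms by (auto simp: elt_last)
  then show "scale (of_int (sign \<sigma>))
      (G (map (\<lambda>m. elt (Ys @ [X]) (\<sigma> m)) [1..<i + 1])
         (map (\<lambda>m. elt (Ys @ [X]) (\<sigma> m)) [i + 1..<i + Suc j + 1])) =
    scale (of_int (sign \<sigma>))
      (G (map (\<lambda>m. elt Ys (\<sigma> m)) [1..<i + 1])
         (map (\<lambda>m. elt Ys (\<sigma> m)) [i + 1..<i + j + 1] @ [X]))"
    by (simp only:)
qed

lemma shuffle_sum_last_in_first_block:
  assumes "length Ys = i + j"
  shows "(\<Sum>\<sigma>\<in>{\<sigma> \<in> shuffle_perms (Suc i) j. \<sigma> (Suc i) = Suc i + j}. scale (of_int (sign \<sigma>))
    (G (map (\<lambda>m. elt (Ys @ [X]) (\<sigma> m)) [1..<Suc i + 1])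
       (map (\<lambda>m. elt (Ys @ [X]) (\<sigma> m)) [Suc i + 1..<Suc i + j + 1]))) =
    parity_sign j (shuffle_sum scale i j (\<lambda>A B. G (A @ [X]) B) Ys)"
  unfolding shuffle_sum_def scale_minus_one_power[symmetric] scale_sum_right
    sum.reindex_bij_betw[OF shuffle_perms_last_in_first_block, symmetric]
proof (rule sum.cong[OF refl])
  fix \<tau> assume \<tau>: "\<tau> \<in> shuffle_perms i j"
  let ?c = "back_cycle (Suc i) j"
  have "permutation ?c"
    by (rule permutes_imp_permutation[OF _ back_cycle_permutes]) simp
  then have sign: "sign (\<tau> \<circ> ?c) = (-1) ^ j * sign \<tau>"
    by (simp add: sign_compose[OF shuffle_perms_permutation[OF \<tau>]] sign_back_cycle)
  have last: "\<tau> (Suc (i + j)) = Suc (i + j)"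
    using \<tau> by (auto simp: shuffle_perms_def intro: permutes_not_in)
  have el: "elt (Ys @ [X]) (\<tau> m) = elt Ys (\<tau> m)" if "m \<in> {1..i + j}" for m
    using shuffle_perms_range[OF \<tau> that] assms by (simp add: elt_append_left)
  have A: "map (\<lambda>m. elt (Ys @ [X]) ((\<tau> \<circ> ?c) m)) [1..<Suc i + 1] =
      map (\<lambda>m. elt Ys (\<tau> m)) [1..<i + 1] @ [X]"
    using el last assms by (auto simp: back_cycle_apply elt_last)
  have B: "map (\<lambda>m. elt (Ys @ [X]) ((\<tau> \<circ> ?c) m)) [Suc i + 1..<Suc i + j + 1] =
      map (\<lambda>m. elt Ys (\<tau> m)) [i + 1..<i + j + 1]"
    by (rule nth_equalityI) (use el in \<open>simp_all add: back_cycle_apply del: upt_Suc\<close>)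
  show "scale (of_int (sign (\<tau> \<circ> ?c)))
      (G (map (\<lambda>m. elt (Ys @ [X]) ((\<tau> \<circ> ?c) m)) [1..<Suc i + 1])
         (map (\<lambda>m. elt (Ys @ [X]) ((\<tau> \<circ> ?c) m)) [Suc i + 1..<Suc i + j + 1])) =
    scale ((-1) ^ j) (scale (of_int (sign \<tau>))
      (G (map (\<lambda>m. elt Ys (\<tau> m)) [1..<i + 1] @ [X]) (map (\<lambda>m. elt Ys (\<tau> m)) [i + 1..<i + j + 1])))"
    unfolding A B sign by simp
qed

text \<open>The largest index ends the second block, where it can simply be dropped, or the first,
  where moving it to the last place costs \<open>(-1) ^ j\<close>. This is the counterpart of
  \<open>unshuffle_sum_snoc\<close>.\<close>

lemma shuffle_sum_snoc:
  assumes "Suc (length Ys) = i + j"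
  shows "shuffle_sum scale i j G (Ys @ [X]) =
    (if j = 0 then 0 else shuffle_sum scale i (j - 1) (\<lambda>A B. G A (B @ [X])) Ys) +
    (if i = 0 then 0 else parity_sign j (shuffle_sum scale (i - 1) j (\<lambda>A B. G (A @ [X]) B) Ys))"
proof -
  define f where "f = (\<lambda>\<sigma>. scale (of_int (sign \<sigma>))
    (G (map (\<lambda>m. elt (Ys @ [X]) (\<sigma> m)) [1..<i + 1])
       (map (\<lambda>m. elt (Ys @ [X]) (\<sigma> m)) [i + 1..<i + j + 1])))"
  define S where "S = (if j = 0 then {} else {\<sigma> \<in> shuffle_perms i j. \<sigma> (i + j) = i + j})"
  define T where "T = (if i = 0 then {} else {\<sigma> \<in> shuffle_perms i j. \<sigma> i = i + j})"
  have ne: "\<sigma> i \<noteq> \<sigma> (i + j)" if "\<sigma> \<in> shuffle_perms i j" "j \<noteq> 0" for \<sigma>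
    using that permutes_inj[of \<sigma> "{1..i + j}"] by (simp add: shuffle_perms_def inj_eq)
  have "S \<inter> T = {}"
  proof (rule equals0I)
    fix \<sigma> assume "\<sigma> \<in> S \<inter> T"
    then have "\<sigma> \<in> shuffle_perms i j" "j \<noteq> 0" "\<sigma> i = \<sigma> (i + j)"
      by (simp_all add: S_def T_def split: if_splits)
    with ne show False by simp
  qed
  moreover have "shuffle_perms i j = S \<union> T"
    using shuffle_perms_last[of _ i j] assms by (auto simp: S_def T_def)
  moreover have "finite S" "finite T"
    by (simp_all add: S_def T_def finite_shuffle_perms)
  ultimately have "shuffle_sum scale i j G (Ys @ [X]) = sum f S + sum f T"
    unfolding shuffle_sum_def f_def by (simp only: sum.union_disjoint)
  moreover have "sum f S = (if j = 0 then 0 else shuffle_sum scale i (j - 1) (\<lambda>A B. G A (B @ [X])) Ys)"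
    using shuffle_sum_last_fixed[of Ys i "j - 1" G X] assms
    by (cases j) (simp_all add: S_def f_def)
  moreover have "sum f T =
      (if i = 0 then 0 else parity_sign j (shuffle_sum scale (i - 1) j (\<lambda>A B. G (A @ [X]) B) Ys))"
    using shuffle_sum_last_in_first_block[of Ys "i - 1" j G X] assms
    by (cases i) (simp_all add: T_def f_def)
  ultimately show ?thesis by simp
qed

text \<open>Splittings of all sizes occur on the left; the condition on \<open>G\<close> selects
  those with \<open>j\<close> entries in \<open>B\<close>. Both sides then obey the same recursion
  in the last entry, the sign \<open>(-1) ^ j\<close> of \<open>shuffle_sum_snoc\<close> turning
  \<open>i * j\<close> into \<open>(i - 1) * j\<close>.\<close>

lemma unshuffle_sum_eq_shuffle_sum:
  assumes "length Xs = i + j" "\<And>A B. length B \<noteq> j \<Longrightarrow> G A B = 0"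
  shows "unshuffle_sum j G Xs = parity_sign (i * j) (shuffle_sum scale i j G Xs)"
  using assms
proof (induction Xs arbitrary: i j G rule: rev_induct)
  case Nil
  then show ?case
    by (simp add: shuffle_sum_def shuffle_perms_0_right parity_sign_def)
next
  case (snoc X Xs)
  have len: "Suc (length Xs) = i + j" using snoc.prems by simp
  have "unshuffle_sum j (\<lambda>A B. G A (B @ [X])) Xs =
    parity_sign (i * j) (if j = 0 then 0 else shuffle_sum scale i (j - 1) (\<lambda>A B. G A (B @ [X])) Xs)"
  proof (cases j)
    case 0
    then show ?thesis
      using unshuffle_sum_zero[of Xs "\<lambda>A B. G A (B @ [X])" 0] snoc.prems(2)
      by (simp add: parity_sign_zero)
  next
    case (Suc j')
    \<comment> \<open>Without \<open>X\<close> the second block has \<open>j'\<close> entries, so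
      the counter is one too large and costs a sign for each of the \<open>i\<close> entries of
      \<open>A\<close>; this makes up the difference between \<open>i * j'\<close> and
      \<open>i * j\<close>.\<close>
    have "unshuffle_sum (Suc j') (\<lambda>A B. G A (B @ [X])) Xs =
        parity_sign i (unshuffle_sum j' (\<lambda>A B. G A (B @ [X])) Xs)"
      unfolding unshuffle_sum_Suc unshuffle_sum_parity_sign[symmetric]
    proof (rule unshuffle_sum_cong)
      fix A B :: "'c list" assume "length A + length B = length Xs"
      then show "parity_sign (length A) (G A (B @ [X])) = parity_sign i (G A (B @ [X]))"
        using snoc.prems(2)[of "B @ [X]" A] len Suc
        by (cases "length B = j'") (simp_all add: parity_sign_zero)
    qed
    also have "unshuffle_sum j' (\<lambda>A B. G A (B @ [X])) Xs =
        parity_sign (i * j') (shuffle_sum scale i j' (\<lambda>A B. G A (B @ [X])) Xs)"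
      by (rule snoc.IH) (use len Suc snoc.prems in auto)
    finally show ?thesis
      using Suc by (simp add: parity_sign_def)
  qed
  moreover have "unshuffle_sum j (\<lambda>A B. parity_sign (j + length B) (G (A @ [X]) B)) Xs =
    parity_sign (i * j)
      (if i = 0 then 0 else parity_sign j (shuffle_sum scale (i - 1) j (\<lambda>A B. G (A @ [X]) B) Xs))"
  proof (cases i)
    case 0
    have "parity_sign (j + length B) (G (A @ [X]) B) = 0"
      if "length A + length B = length Xs" for A B
      using that len 0 snoc.prems(2)[of B "A @ [X]"] by (simp add: parity_sign_zero)
    then show ?thesis
      using 0 by (simp add: unshuffle_sum_zero parity_sign_zero)
  next
    case (Suc i')
    \<comment> \<open>Where \<open>G\<close> does not vanish, \<open>B\<close> has length
      \<open>j\<close>, so \<open>j + length B\<close> is even.\<close>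
    have "unshuffle_sum j (\<lambda>A B. parity_sign (j + length B) (G (A @ [X]) B)) Xs =
        unshuffle_sum j (\<lambda>A B. G (A @ [X]) B) Xs"
      using snoc.prems(2) by (intro unshuffle_sum_cong, case_tac "length B = j")
        (simp_all add: parity_sign_def)
    also have "\<dots> = parity_sign (i' * j) (shuffle_sum scale i' j (\<lambda>A B. G (A @ [X]) B) Xs)"
      by (rule snoc.IH) (use len Suc snoc.prems in auto)
    finally show ?thesis
      using Suc by (simp add: parity_sign_def)
  qed
  ultimately show ?case
    unfolding unshuffle_sum_snoc shuffle_sum_snoc[OF len] by (simp only: parity_sign_add)
qed

end

section \<open>Comparison with the shuffle formulas\<close>

definition end_term ::
  "'v::ab_group_add joint_cochain \<Rightarrow> 'v joint_cochain \<Rightarrow> 'v + 'v \<times> 'v \<Rightarrow>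
   ('v \<times> 'v) list \<Rightarrow> ('v \<times> 'v) list \<Rightarrow> 'v" where
  "end_term F Q e A B = (case e of
      Inl x \<Rightarrow> F A (Inl (Q B (Inl x)))
    | Inr (x, y) \<Rightarrow> F A (Inl (Q B (Inr (x, y)))) +
        F A (Inr (x, Q B (Inl y))) + F A (Inr (Q B (Inl x), y)))"

text \<open>\<open>X\<close> is the pair acted on; \<open>A\<close> and \<open>B\<close> come from
  splitting the entries before it, and \<open>R\<close> collects the entries behind it.\<close>

definition insertion_term ::
  "(('v \<times> 'v) list \<Rightarrow> 'v::ab_group_add) \<Rightarrow> (('v \<times> 'v) list \<Rightarrow> 'v \<Rightarrow> 'v) \<Rightarrow>
   'v \<times> 'v \<Rightarrow> ('v \<times> 'v) list \<Rightarrow> ('v \<times> 'v) list \<Rightarrow> ('v \<times> 'v) list \<Rightarrow> 'v" where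
  "insertion_term F f X R A B =
    F (A @ (fst X, f B (snd X)) # R) + F (A @ (f B (fst X), snd X) # R)"

text \<open>Unrolling the recursion: entries are dealt to \<open>B\<close> or \<open>A\<close> until
  one of them, \<open>Xs ! m\<close>, is acted on, after which the tail is left to \<open>F\<close>
  in its order. If no entry is acted on, the end is.\<close>

lemma joint_circ_eq_unshuffle_sum:
  "joint_circ q F Q Xs e = unshuffle_sum q (end_term F Q e) Xs +
    (\<Sum>m<length Xs. unshuffle_sum q
      (insertion_term (\<lambda>Ys. F Ys e) (\<lambda>B x. Q B (Inl x)) (Xs ! m) (drop (Suc m) Xs)) (take m Xs))"
proof (induction Xs arbitrary: q F Q)
  case Nil
  show ?case
    by (cases e) (auto simp: end_term_def)
next
  case (Cons X Xs)
  have "end_term F (contract X Q) e = (\<lambda>A B. end_term F Q e A (X # B))"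
    "end_term (contract X F) Q e = (\<lambda>A B. end_term F Q e (X # A) B)"
    by (auto simp: end_term_def contract_def fun_eq_iff split: sum.split)
  moreover have "insertion_term (\<lambda>Ys. F Ys e) (\<lambda>B x. contract X Q B (Inl x)) Y R =
      (\<lambda>A B. insertion_term (\<lambda>Ys. F Ys e) (\<lambda>B x. Q B (Inl x)) Y R A (X # B))"
    "insertion_term (\<lambda>Ys. contract X F Ys e) (\<lambda>B x. Q B (Inl x)) Y R =
      (\<lambda>A B. insertion_term (\<lambda>Ys. F Ys e) (\<lambda>B x. Q B (Inl x)) Y R (X # A) B)" for Y R
    by (simp_all add: insertion_term_def contract_def fun_eq_iff)
  moreover have "(\<Sum>m<n. parity_sign q (f m)) = parity_sign q (\<Sum>m<n. f m)" for n and f :: "nat \<Rightarrow> 'a"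
    by (simp add: parity_sign_def sum_negf)
  ultimately show ?case
    unfolding joint_circ.simps(3) Cons.IH
    by (simp only: list.size(4) add_0_right add_Suc_right sum.lessThan_Suc_shift
        nth_Cons_0 nth_Cons_Suc drop_Suc_Cons drop0 take_0 take_Suc_Cons unshuffle_sum.simps sum.distrib parity_sign_add)
      (simp add: insertion_term_def add_ac)
qed

text \<open>An end \<open>Inr X\<close> counts as an entry, so \<open>n - 1\<close> pairs precede
  it. Written with \<open>Suc\<close>, the condition makes all values at such ends vanish in degree
  \<open>0\<close>.\<close>

definition homogeneous :: "nat \<Rightarrow> 'v::zero joint_cochain \<Rightarrow> bool" where
  "homogeneous n F \<longleftrightarrow> (\<forall>Xs x. length Xs \<noteq> n \<longrightarrow> F Xs (Inl x) = 0) \<and>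
    (\<forall>Xs X. Suc (length Xs) \<noteq> n \<longrightarrow> F Xs (Inr X) = 0)"

lemma homogeneous_odd_part_vanishes: "homogeneous n F \<Longrightarrow> odd_part_vanishes n F"
  by (auto simp: homogeneous_def odd_part_vanishes_def)

lemma multilinear_entry_zero:
  assumes "multilinear s F"
  shows "F (A @ (0, b) # R) e = 0" "F (A @ (b, 0) # R) e = 0"
proof -
  have "alternating_bilinear s (\<lambda>a b. F (A @ (a, b) # R) e)"
    using assms unfolding multilinear_def by blast
  from alternating_bilinear_zero[OF this]
  show "F (A @ (0, b) # R) e = 0" "F (A @ (b, 0) # R) e = 0" .
qed

lemma homogeneous_joint_circ:
  assumes F: "homogeneous p F" "multilinear s F" and Q: "homogeneous q Q"
  shows "homogeneous (p + q) (joint_circ q F Q)"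
proof -
  note z = multilinear_zero_args[OF F(2)] multilinear_entry_zero[OF F(2)]
  have "unshuffle_sum q (end_term F Q e) Xs = 0"
    if "length Xs + (case e of Inl _ \<Rightarrow> 0 | Inr _ \<Rightarrow> 1) \<noteq> p + q" for Xs e
  proof (rule unshuffle_sum_zero)
    fix A B :: "('a \<times> 'a) list" assume len: "length A + length B = length Xs"
    show "end_term F Q e A B = 0"
      using F(1) Q that len
      by (cases "length B = q"; cases "Suc (length B) = q")
        (auto simp: end_term_def homogeneous_def z split: sum.splits)
  qed
  moreover have "unshuffle_sum q
      (insertion_term (\<lambda>Ys. F Ys e) (\<lambda>B x. Q B (Inl x)) (Xs ! m) (drop (Suc m) Xs)) (take m Xs) = 0"
    if "length Xs + (case e of Inl _ \<Rightarrow> 0 | Inr _ \<Rightarrow> 1) \<noteq> p + q" "m < length Xs" for Xs e m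
  proof (rule unshuffle_sum_zero)
    fix A B :: "('a \<times> 'a) list" assume "length A + length B = length (take m Xs)"
    then show "insertion_term (\<lambda>Ys. F Ys e) (\<lambda>B x. Q B (Inl x)) (Xs ! m) (drop (Suc m) Xs) A B = 0"
      using F(1) Q that
      by (cases "length B = q") (auto simp: insertion_term_def homogeneous_def z split: sum.splits)
  qed
  ultimately show ?thesis
    by (auto simp: homogeneous_def joint_circ_eq_unshuffle_sum)
qed

lemma map_elt_upt: "map (elt Xs) [Suc a..<Suc b] = take (b - a) (drop a Xs)" if "b \<le> length Xs"
  by (rule nth_equalityI) (use that in \<open>auto simp: elt_def nth_append simp del: upt_Suc\<close>)

lemma shuffle_sum_take:
  assumes "i + j \<le> length Xs"
  shows "shuffle_sum scale i j G (take (i + j) Xs) = shuffle_sum scale i j G Xs"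
  unfolding shuffle_sum_def
proof (rule sum.cong[OF refl])
  fix \<sigma> assume \<sigma>: "\<sigma> \<in> shuffle_perms i j"
  have "elt (take (i + j) Xs) (\<sigma> m) = elt Xs (\<sigma> m)" if "m \<in> {1..i + j}" for m
    using shuffle_perms_range[OF \<sigma> that] assms by (auto simp: elt_def)
  then have "map (\<lambda>m. elt (take (i + j) Xs) (\<sigma> m)) [1..<i + 1] = map (\<lambda>m. elt Xs (\<sigma> m)) [1..<i + 1]"
    "map (\<lambda>m. elt (take (i + j) Xs) (\<sigma> m)) [i + 1..<i + j + 1] =
      map (\<lambda>m. elt Xs (\<sigma> m)) [i + 1..<i + j + 1]"
    by (auto simp del: upt_Suc)
  then show "scale (of_int (sign \<sigma>))
      (G (map (\<lambda>m. elt (take (i + j) Xs) (\<sigma> m)) [1..<i + 1])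
         (map (\<lambda>m. elt (take (i + j) Xs) (\<sigma> m)) [i + 1..<i + j + 1])) =
    scale (of_int (sign \<sigma>)) (G (map (\<lambda>m. elt Xs (\<sigma> m)) [1..<i + 1])
       (map (\<lambda>m. elt Xs (\<sigma> m)) [i + 1..<i + j + 1]))"
    by (simp only:)
qed

lemma sum_lessThan_add_zero:
  fixes f :: "nat \<Rightarrow> 'a::comm_monoid_add"
  assumes "\<And>m. m < q \<Longrightarrow> f m = 0"
  shows "(\<Sum>m<p + q. f m) = (\<Sum>m<p. f (m + q))"
  by (induction p) (simp_all add: assms)

context vector_space
begin

lemma shuffle_sum_add:
  "shuffle_sum scale i j (\<lambda>A B. G A B + H A B) Xs =
    shuffle_sum scale i j G Xs + shuffle_sum scale i j H Xs"
  by (simp add: shuffle_sum_def scale_right_distrib sum.distrib)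

lemma insertion_sum_eq_shuffle_sum:
  assumes len: "length Xs = p + q"
  shows "insertion_sum scale p q F Q Xs = (\<Sum>m<p. parity_sign (m * q)
    (shuffle_sum scale m q (insertion_term F (snd Q) (Xs ! (m + q)) (drop (Suc (m + q)) Xs))
      (take (m + q) Xs)))"
proof -
  have rest: "map (elt Xs) [Suc (Suc (m + q))..<Suc (p + q)] = drop (Suc (m + q)) Xs"
    if "m < p" for m
    using map_elt_upt[of "p + q" Xs "Suc (m + q)"] len by (simp del: upt_Suc)
  have el: "elt Xs (Suc (m + q)) = Xs ! (m + q)" for m
    by (simp add: elt_def)
  have "insertion_sum scale p q F Q Xs =
    (\<Sum>m<p. scale ((-1) ^ (m * q)) (shuffle_sum scale m q
      (\<lambda>A B. F (A @ [(fst (Xs ! (m + q)), snd Q B (snd (Xs ! (m + q))))] @ drop (Suc (m + q)) Xs)) Xs)) +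
    (\<Sum>m<p. scale ((-1) ^ (m * q)) (shuffle_sum scale m q
      (\<lambda>A B. F (A @ [(snd Q B (fst (Xs ! (m + q))), snd (Xs ! (m + q)))] @ drop (Suc (m + q)) Xs)) Xs))"
    unfolding insertion_sum_def Let_def shuffle_sum_def One_nat_def sum.atLeast1_atMost_eq
    by (intro arg_cong2[of _ _ _ _ "(+)"] sum.cong refl) (simp_all add: rest el del: upt_Suc)
  also have "\<dots> = (\<Sum>m<p. parity_sign (m * q)
    (shuffle_sum scale m q (insertion_term F (snd Q) (Xs ! (m + q)) (drop (Suc (m + q)) Xs))
      (take (m + q) Xs)))"
    unfolding sum.distrib[symmetric]
  proof (rule sum.cong[OF refl])
    fix m assume "m \<in> {..<p}"
    then have "m + q \<le> length Xs" using len by simp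
    then show "scale ((-1) ^ (m * q)) (shuffle_sum scale m q
      (\<lambda>A B. F (A @ [(fst (Xs ! (m + q)), snd Q B (snd (Xs ! (m + q))))] @ drop (Suc (m + q)) Xs)) Xs) +
     scale ((-1) ^ (m * q)) (shuffle_sum scale m q
      (\<lambda>A B. F (A @ [(snd Q B (fst (Xs ! (m + q))), snd (Xs ! (m + q)))] @ drop (Suc (m + q)) Xs)) Xs) =
     parity_sign (m * q)
      (shuffle_sum scale m q (insertion_term F (snd Q) (Xs ! (m + q)) (drop (Suc (m + q)) Xs))
       (take (m + q) Xs))"
      by (simp add: shuffle_sum_take insertion_term_def[abs_def] shuffle_sum_add
          scale_minus_one_power parity_sign_add)
  qed
  finally show ?thesis .
qed

text \<open>The summation index becomes the zero-based position \<open>m = k + q - 1\<close> of the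
  pair acted on. Positions below \<open>q\<close> contribute nothing, as too few entries precede
  them to fill \<open>Q\<close>.\<close>

lemma insertion_sum_eq_unshuffle_sum:
  assumes len: "length Xs = p + q"
    and Q: "\<And>B x. length B \<noteq> q \<Longrightarrow> snd Q B x = 0"
    and F: "\<And>A R a. F (A @ (0, a) # R) = 0" "\<And>A R a. F (A @ (a, 0) # R) = 0"
  shows "insertion_sum scale p q F Q Xs = (\<Sum>m<length Xs.
    unshuffle_sum q (insertion_term F (snd Q) (Xs ! m) (drop (Suc m) Xs)) (take m Xs))"
proof -
  have "unshuffle_sum q (insertion_term F (snd Q) (Xs ! m) (drop (Suc m) Xs)) (take m Xs) = 0"
    if "m < q" for m
    by (rule unshuffle_sum_zero) (use that in \<open>simp add: insertion_term_def Q F\<close>)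
  moreover have "unshuffle_sum q (insertion_term F (snd Q) X R) (take (m + q) Xs) =
    parity_sign (m * q) (shuffle_sum scale m q (insertion_term F (snd Q) X R) (take (m + q) Xs))"
    if "m < p" for m X R
    by (rule unshuffle_sum_eq_shuffle_sum) (use that len in \<open>simp_all add: insertion_term_def Q F\<close>)
  ultimately show ?thesis
    by (simp add: insertion_sum_eq_shuffle_sum[OF len] len sum_lessThan_add_zero)
qed

lemma insertion_sum_0:
  assumes "length Xs = p"
  shows "insertion_sum scale p 0 F Q Xs = derivation_sum p F (snd Q []) Xs"
proof -
  have "map (elt Xs) [Suc 0..<Suc m] = take m Xs" if "m \<le> p" for m
    using map_elt_upt[of m Xs 0] assms that by (simp del: upt_Suc)
  moreover have "map (elt Xs) [Suc (Suc m)..<Suc p] = drop (Suc m) Xs" for m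
    using map_elt_upt[of p Xs "Suc m"] assms by (simp del: upt_Suc)
  ultimately show ?thesis
    unfolding insertion_sum_def derivation_sum_def Let_def One_nat_def sum.atLeast1_atMost_eq
      sum.distrib
    using assms
    by (intro arg_cong2[of _ _ _ _ "(+)"] sum.cong refl)
      (simp_all add: shuffle_perms_0_right upd_conv_take_nth_drop del: upt_Suc)
qed

lemma map_elt_all: "length Xs = n \<Longrightarrow> map (elt Xs) [Suc 0..<Suc n] = Xs"
  using map_elt_upt[of n Xs 0] by (simp del: upt_Suc)

lemma insertion_sum_no_entries: "insertion_sum scale 0 q F Q Xs = 0"
  by (simp add: insertion_sum_def)

lemma cochains_II_zero:
  assumes "P \<in> cochains scale p"
  shows "snd P Xs 0 = 0"
proof (cases "length Xs = p")
  case True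
  then show ?thesis
    using assms by (intro linear_map_zero[of scale]) (auto simp: cochains_def hom_II_def)
qed (use assms in \<open>auto simp: cochains_def hom_II_def\<close>)

text \<open>A block of length 0 leaves only the identity shuffle. For \<open>p = 0\<close> the
  identity meets the condition on the last place and there are no insertions; for
  \<open>q = 0\<close> the first sum dies with \<open>fst Q = 0\<close> and the insertions become
  \<open>derivation_sum\<close>.\<close>

lemma fst_circ:
  assumes P: "P \<in> cochains scale p" and Q: "Q \<in> cochains scale q"
    and "length Xs = p + q" "0 < p + q"
  shows "fst (circ scale p q P Q) Xs = circ_pos_I scale p q P Q Xs"
proof -
  consider "p = 0" "0 < q" | "0 < p" "q = 0" | "0 < p" "0 < q"
    using assms(4) by linarith
  then show ?thesis
  proof cases
    case 1
    moreover have "{\<sigma>. \<sigma> = id \<and> \<sigma> q = q} = {id}" by auto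
    ultimately show ?thesis
      using assms(3) by (simp add: circ_def circ_pos_I_def shuffle_perms_0_left
          insertion_sum_no_entries map_elt_all del: upt_Suc)
  next
    case 2
    then have "fst Q = 0"
      using Q by (auto simp: cochains_def)
    with 2 show ?thesis
      using assms(3) by (simp add: circ_def circ_pos_I_def insertion_sum_0 cochains_II_zero[OF P])
  qed (use assms(3) in \<open>simp add: circ_def\<close>)
qed

lemma snd_circ:
  assumes "length Xs = p + q"
  shows "snd (circ scale p q P Q) Xs x = circ_pos_II scale p q P Q Xs x"
proof -
  consider "p = 0" | "0 < p" "q = 0" | "0 < p" "0 < q"
    by linarith
  then show ?thesis
  proof cases
    case 1
    then show ?thesis
      using assms by (simp add: circ_def circ_pos_II_def shuffle_perms_0_left
          insertion_sum_no_entries map_elt_all del: upt_Suc)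
  next
    case 2
    then show ?thesis
      using assms by (simp add: circ_def circ_pos_II_def shuffle_perms_0_right insertion_sum_0
          map_elt_all del: upt_Suc)
  qed (use assms in \<open>simp add: circ_def\<close>)
qed

end

section \<open>Passing between cochains and joint cochains\<close>

lemma joint_simps [simp]:
  "joint P Xs (Inl x) = snd P Xs x" "joint P Xs (Inr X) = fst P (Xs @ [X])"
  by (simp_all add: joint_def)

lemma joint_add: "joint (P + Q) = joint P + joint Q"
  by (simp add: joint_def fun_eq_iff split: sum.split)

lemma joint_diff: "joint (P - Q) = joint P - joint Q"
  by (simp add: joint_def fun_eq_iff split: sum.split)

lemma joint_cochain_scale: "joint (cochain_scale s c P) = (\<lambda>Xs e. s c (joint P Xs e))"
  by (simp add: joint_def cochain_scale_def fun_eq_iff split: sum.split)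

text \<open>The first component enters \<open>joint\<close> only at lists ending in a pair, so
  \<open>fst P []\<close> is exactly what \<open>joint\<close> forgets.\<close>

lemma joint_eqI:
  assumes "joint P = joint Q" "fst P [] = fst Q []"
  shows "P = Q"
proof (rule prod_eqI; rule ext)
  show "fst P Xs = fst Q Xs" for Xs
    using fun_cong[OF fun_cong[OF assms(1)], of "butlast Xs" "Inr (last Xs)"] assms(2)
    by (cases "Xs = []") simp_all
  show "snd P Xs = snd Q Xs" for Xs
    using fun_cong[OF fun_cong[OF assms(1)], of Xs "Inl _"] by (simp add: fun_eq_iff)
qed

lemma cochains_fst_Nil: "P \<in> cochains s p \<Longrightarrow> fst P [] = 0"
  by (auto simp: cochains_def hom_I_def split: if_splits)

lemma homogeneous_joint: "P \<in> cochains s p \<Longrightarrow> homogeneous p (joint P)"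
  by (auto simp: homogeneous_def cochains_def hom_I_def hom_II_def split: if_splits)

context vector_space
begin

lemma linear_map_const_zero: "Vector_Spaces.linear scale scale (\<lambda>x. 0)"
  by (rule linear_mapI) simp_all

lemma alternating_bilinear_const_zero: "alternating_bilinear scale (\<lambda>x y. 0)"
  by (rule alternating_bilinearI) (simp_all add: linear_map_const_zero)

lemma cochains_I_alternating:
  assumes "P \<in> cochains scale p"
  shows "alternating_bilinear scale (\<lambda>a b. fst P (As @ (a, b) # Bs))"
proof (cases "length As + length Bs + 1 = p")
  case True
  \<comment> \<open>The pair \<open>(0, 0)\<close> only holds the place that the update
    overwrites.\<close>
  then have "alternating_bilinear scale
      (\<lambda>a b. fst P ((As @ (0, 0) # Bs)[length As := (a, b)]))"
    using assms
    by (simp add: cochains_def hom_I_def mem_Times_iff del: list_update_append list_update_length)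
  then show ?thesis by simp
next
  case False
  then have "(\<lambda>a b. fst P (As @ (a, b) # Bs)) = (\<lambda>a b. 0)"
    using assms by (auto simp: cochains_def hom_I_def fun_eq_iff split: if_splits)
  then show ?thesis by (simp only: alternating_bilinear_const_zero)
qed

lemma cochains_II_alternating:
  assumes "P \<in> cochains scale p"
  shows "alternating_bilinear scale (\<lambda>a b. snd P (As @ (a, b) # Bs) x)"
proof (cases "length As + length Bs + 1 = p")
  case True
  then have "alternating_bilinear scale
      (\<lambda>a b. snd P ((As @ (0, 0) # Bs)[length As := (a, b)]) x)"
    using assms
    by (simp add: cochains_def hom_II_def mem_Times_iff del: list_update_append list_update_length)
  then show ?thesis by simp
next
  case False
  then have "(\<lambda>a b. snd P (As @ (a, b) # Bs) x) = (\<lambda>a b. 0)"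
    using assms by (auto simp: cochains_def hom_II_def fun_eq_iff)
  then show ?thesis by (simp only: alternating_bilinear_const_zero)
qed

lemma cochains_II_linear:
  assumes "P \<in> cochains scale p"
  shows "Vector_Spaces.linear scale scale (snd P Xs)"
proof (cases "length Xs = p")
  case False
  then have "snd P Xs = (\<lambda>x. 0)"
    using assms by (auto simp: cochains_def hom_II_def fun_eq_iff)
  then show ?thesis by (simp only: linear_map_const_zero)
qed (use assms in \<open>auto simp: cochains_def hom_II_def\<close>)

lemma multilinear_joint:
  assumes "P \<in> cochains scale p"
  shows "multilinear scale (joint P)"
  unfolding multilinear_def
proof (intro conjI allI)
  show "alternating_bilinear scale (\<lambda>a b. joint P (As @ (a, b) # Bs) e)" for As Bs e
    using cochains_I_alternating[OF assms] cochains_II_alternating[OF assms] by (cases e) simp_all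
  show "Vector_Spaces.linear scale scale (\<lambda>x. joint P As (Inl x))" for As
    using cochains_II_linear[OF assms] by simp
  show "alternating_bilinear scale (\<lambda>a b. joint P As (Inr (a, b)))" for As
    using cochains_I_alternating[OF assms, of As "[]"] by simp
qed

text \<open>The converse of \<open>multilinear_joint\<close> and \<open>homogeneous_joint\<close>;
  through it \<open>circ\<close> inherits membership from \<open>joint_circ\<close>.\<close>

lemma cochainsI:
  assumes ml: "multilinear scale (joint P)" and hom: "homogeneous p (joint P)"
    and nil: "fst P [] = 0"
  shows "P \<in> cochains scale p"
proof -
  have zero: "fst P Xs = 0" if "length Xs \<noteq> p" for Xs
  proof (cases Xs rule: rev_cases)
    case (snoc Ys Y)
    then have "joint P Ys (Inr Y) = 0"
      using hom that by (cases Y) (simp add: homogeneous_def del: joint_simps)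
    then show ?thesis using snoc by simp
  qed (simp add: nil)
  have "fst P \<in> hom_I scale p" if "p \<noteq> 0"
    unfolding hom_I_def
  proof (rule CollectI, intro conjI allI impI)
    fix Xs :: "('b \<times> 'b) list" and k
    assume "length Xs = p \<and> k < p"
    then have k: "k < length Xs" by simp
    \<comment> \<open>If \<open>k\<close> is the last place, the updated pair is itself the end;
      otherwise the end is the last pair \<open>Y\<close> and the update happens before it.\<close>
    show "alternating_bilinear scale (\<lambda>a b. fst P (Xs[k := (a, b)]))"
    proof (cases "drop (Suc k) Xs" rule: rev_cases)
      case Nil
      then show ?thesis
        using multilinearD(4)[OF ml, of "take k Xs"] k by (simp add: upd_conv_take_nth_drop)
    next
      case (snoc Ys Y)
      then show ?thesis
        using multilinearD(1)[OF ml, of "take k Xs" Ys "Inr Y"] k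
        by (simp add: upd_conv_take_nth_drop)
    qed
  qed (rule zero)
  moreover have "fst P = 0" if "p = 0"
  proof (rule ext)
    show "fst P Xs = 0 Xs" for Xs
      using zero[of Xs] nil that by (cases "Xs = []") simp_all
  qed
  moreover have "snd P \<in> hom_II scale p"
    unfolding hom_II_def
  proof (rule CollectI, intro conjI allI impI)
    fix Xs :: "('b \<times> 'b) list" and k x
    assume "length Xs = p \<and> k < p"
    then show "alternating_bilinear scale (\<lambda>a b. snd P (Xs[k := (a, b)]) x)"
      using multilinearD(1)[OF ml, of "take k Xs" "drop (Suc k) Xs" "Inl x"]
      by (simp add: upd_conv_take_nth_drop)
  qed (use hom multilinearD(3)[OF ml] in \<open>simp_all add: homogeneous_def\<close>)
  ultimately show ?thesis
    by (cases P) (simp add: cochains_def)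
qed

lemma circ_pos_II_eq_joint_circ:
  assumes P: "P \<in> cochains scale p" and Q: "Q \<in> cochains scale q"
    and len: "length Xs = p + q"
  shows "circ_pos_II scale p q P Q Xs x = joint_circ q (joint P) (joint Q) Xs (Inl x)"
proof -
  have Q0: "snd Q B y = 0" if "length B \<noteq> q" for B y
    using Q that by (auto simp: cochains_def hom_II_def)
  note P0 = alternating_bilinear_zero[OF cochains_II_alternating[OF P]]
  have "insertion_sum scale p q (\<lambda>Ys. snd P Ys x) Q Xs = (\<Sum>m<length Xs.
    unshuffle_sum q (insertion_term (\<lambda>Ys. snd P Ys x) (snd Q) (Xs ! m) (drop (Suc m) Xs)) (take m Xs))"
    by (rule insertion_sum_eq_unshuffle_sum[OF len]) (simp_all add: Q0 P0)
  moreover have "unshuffle_sum q (\<lambda>A B. snd P A (snd Q B x)) Xs =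
    parity_sign (p * q) (shuffle_sum scale p q (\<lambda>A B. snd P A (snd Q B x)) Xs)"
    by (rule unshuffle_sum_eq_shuffle_sum[OF len]) (simp add: Q0 cochains_II_zero[OF P])
  moreover have "end_term (joint P) (joint Q) (Inl x) = (\<lambda>A B. snd P A (snd Q B x))"
    by (simp add: end_term_def fun_eq_iff)
  ultimately show ?thesis
    by (simp add: circ_pos_II_def joint_circ_eq_unshuffle_sum shuffle_sum_def
        scale_minus_one_power[symmetric] scale_sum_right del: upt_Suc)
qed

text \<open>The last pair plays the end. Insertions into it supply two of the three summands of
  \<open>end_term\<close>, and the sum restricted by \<sigma>(p + q) = p + q supplies the third;
  insertions into earlier pairs leave the last pair as the end of \<open>P\<close>.\<close>

lemma circ_pos_I_eq_joint_circ:
  assumes P: "P \<in> cochains scale p" and Q: "Q \<in> cochains scale q"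
    and len: "Suc (length Xs) = p + q"
  shows "circ_pos_I scale p q P Q (Xs @ [(x, y)]) =
    joint_circ q (joint P) (joint Q) Xs (Inr (x, y))"
proof -
  have len': "length (Xs @ [(x, y)]) = p + q" using len by simp
  have Q0: "snd Q B z = 0" if "length B \<noteq> q" for B z
    using Q that by (auto simp: cochains_def hom_II_def)
  have QI0: "fst Q B = 0" if "length B \<noteq> q" for B
    using Q that by (auto simp: cochains_def hom_I_def split: if_splits)
  have P0: "snd P A z = 0" if "length A \<noteq> p" for A z
    using P that by (auto simp: cochains_def hom_II_def)
  have ins: "insertion_sum scale p q (fst P) Q (Xs @ [(x, y)]) =
    (\<Sum>m<length Xs. unshuffle_sum q (insertion_term (\<lambda>Ys. joint P Ys (Inr (x, y)))
      (\<lambda>B z. joint Q B (Inl z)) (Xs ! m) (drop (Suc m) Xs)) (take m Xs)) +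
    unshuffle_sum q (\<lambda>A B. fst P (A @ [(x, snd Q B y)]) + fst P (A @ [(snd Q B x, y)])) Xs"
  proof -
    have "insertion_sum scale p q (fst P) Q (Xs @ [(x, y)]) = (\<Sum>m<Suc (length Xs).
        unshuffle_sum q (insertion_term (fst P) (snd Q) ((Xs @ [(x, y)]) ! m)
          (drop (Suc m) (Xs @ [(x, y)]))) (take m (Xs @ [(x, y)])))"
      using insertion_sum_eq_unshuffle_sum[OF len', of Q "fst P"] Q0
        alternating_bilinear_zero[OF cochains_I_alternating[OF P]] by simp
    then show ?thesis
      by (simp add: nth_append insertion_term_def[abs_def])
  qed
  have first: "(\<Sum>\<sigma>\<in>{\<sigma> \<in> shuffle_perms p q. \<sigma> (p + q) = p + q}.
      scale ((-1) ^ (p * q) * of_int (sign \<sigma>))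
        (snd P (map (\<lambda>i. elt (Xs @ [(x, y)]) (\<sigma> i)) [1..<p + 1])
          (fst Q (map (\<lambda>i. elt (Xs @ [(x, y)]) (\<sigma> i)) [p + 1..<p + q + 1])))) =
    unshuffle_sum q (\<lambda>A B. snd P A (fst Q (B @ [(x, y)]))) Xs"
  proof (cases q)
    case 0
    then show ?thesis
      using QI0 by (simp add: shuffle_perms_0_right cochains_fst_Nil[OF Q] cochains_II_zero[OF P]
          unshuffle_sum_zero)
  next
    case (Suc q')
    let ?G = "\<lambda>A B. snd P A (fst Q (B @ [(x, y)]))"
    have len'': "length Xs = p + q'" using len Suc by simp
    \<comment> \<open>Of the \<open>q\<close> arguments of \<open>fst Q\<close> one is the end, so
      \<open>B\<close> has only \<open>q'\<close> entries. The surplus of one in the counter gives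
      \<open>(-1) ^ p\<close>, which completes \<open>(-1) ^ (p * q')\<close> to
      \<open>(-1) ^ (p * q)\<close>.\<close>
    have "unshuffle_sum q ?G Xs = unshuffle_sum q' (\<lambda>A B. parity_sign (length A) (?G A B)) Xs"
      by (simp add: Suc unshuffle_sum_Suc)
    also have "\<dots> = unshuffle_sum q' (\<lambda>A B. parity_sign p (?G A B)) Xs"
    proof (rule unshuffle_sum_cong)
      show "parity_sign (length A) (?G A B) = parity_sign p (?G A B)" for A B
        using P0[of A] by (cases "length A = p") (simp_all add: parity_sign_zero)
    qed
    also have "\<dots> = parity_sign p (parity_sign (p * q') (shuffle_sum scale p q' ?G Xs))"
      unfolding unshuffle_sum_parity_sign
      by (subst unshuffle_sum_eq_shuffle_sum[OF len'']) (simp_all add: QI0 Suc cochains_II_zero[OF P])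
    also have "\<dots> = parity_sign (p * q) (shuffle_sum scale p q' ?G Xs)"
      by (simp add: parity_sign_def Suc)
    also have "shuffle_sum scale p q' ?G Xs = (\<Sum>\<sigma>\<in>{\<sigma> \<in> shuffle_perms p q. \<sigma> (p + q) = p + q}.
      scale (of_int (sign \<sigma>)) (snd P (map (\<lambda>i. elt (Xs @ [(x, y)]) (\<sigma> i)) [1..<p + 1])
        (fst Q (map (\<lambda>i. elt (Xs @ [(x, y)]) (\<sigma> i)) [p + 1..<p + q + 1]))))"
      unfolding Suc by (rule shuffle_sum_last_fixed[OF len'', symmetric])
    finally show ?thesis
      by (simp only: scale_minus_one_power[symmetric] scale_sum_right scale_scale)
  qed
  have "end_term (joint P) (joint Q) (Inr (x, y)) = (\<lambda>A B. snd P A (fst Q (B @ [(x, y)])) +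
      (fst P (A @ [(x, snd Q B y)]) + fst P (A @ [(snd Q B x, y)])))"
    by (simp add: end_term_def fun_eq_iff add.assoc)
  then show ?thesis
    unfolding circ_pos_I_def first ins joint_circ_eq_unshuffle_sum
    by (simp add: unshuffle_sum_add add_ac)
qed

text \<open>Off the total degree \<open>circ\<close> is zero by definition and
  \<open>joint_circ\<close> by homogeneity. Bilinearity and the Jacobi identity are transferred to
  \<open>circ\<close> along this equation.\<close>

lemma joint_circ_joint:
  assumes P: "P \<in> cochains scale p" and Q: "Q \<in> cochains scale q"
  shows "joint (circ scale p q P Q) = joint_circ q (joint P) (joint Q)"
proof (intro ext)
  fix Xs e
  have hom: "homogeneous (p + q) (joint_circ q (joint P) (joint Q))"
    by (rule homogeneous_joint_circ[OF homogeneous_joint[OF P] multilinear_joint[OF P]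
          homogeneous_joint[OF Q]])
  show "joint (circ scale p q P Q) Xs e = joint_circ q (joint P) (joint Q) Xs e"
  proof (cases e)
    case (Inl x)
    show ?thesis
    proof (cases "length Xs = p + q")
      case True
      then show ?thesis
        using Inl by (simp add: snd_circ circ_pos_II_eq_joint_circ[OF P Q])
    next
      case False
      then show ?thesis
        using Inl hom by (simp add: homogeneous_def) (simp add: circ_def)
    qed
  next
    case (Inr X)
    show ?thesis
    proof (cases "Suc (length Xs) = p + q")
      case True
      then have "fst (circ scale p q P Q) (Xs @ [X]) = circ_pos_I scale p q P Q (Xs @ [X])"
        by (intro fst_circ[OF P Q]) auto
      then show ?thesis
        using Inr True by (cases X) (simp add: circ_pos_I_eq_joint_circ[OF P Q])
    next
      case False
      then show ?thesis
        using Inr hom by (cases X) (simp add: homogeneous_def, simp add: circ_def)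
    qed
  qed
qed

lemma circ_fst_Nil:
  "P \<in> cochains scale p \<Longrightarrow> Q \<in> cochains scale q \<Longrightarrow> fst (circ scale p q P Q) [] = 0"
  by (simp add: circ_def)

lemma circ_cochains:
  assumes "P \<in> cochains scale p" "Q \<in> cochains scale q"
  shows "circ scale p q P Q \<in> cochains scale (p + q)"
  by (rule cochainsI)
    (simp_all add: joint_circ_joint[OF assms] circ_fst_Nil[OF assms] multilinear_joint_circ
      multilinear_joint[OF assms(1)] multilinear_joint[OF assms(2)]
      homogeneous_joint_circ[OF homogeneous_joint[OF assms(1)] multilinear_joint[OF assms(1)]
          homogeneous_joint[OF assms(2)]])

end

section \<open>The graded Lie algebra\<close>

lemma homogeneous_part_add:
  fixes P Q :: "'v::ab_group_add cochain"
  shows "homogeneous_part p (P + Q) = homogeneous_part p P + homogeneous_part p Q"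
  by (auto simp: homogeneous_part_def fun_eq_iff)

lemma cochain_scale_simps:
  "fst (cochain_scale s c P) Xs = s c (fst P Xs)" "snd (cochain_scale s c P) Xs x = s c (snd P Xs x)"
  by (simp_all add: cochain_scale_def)

lemma cochain_eqI:
  "(\<And>Xs. fst P Xs = fst Q Xs) \<Longrightarrow> (\<And>Xs x. snd P Xs x = snd Q Xs x) \<Longrightarrow> P = (Q :: 'v cochain)"
  by (intro prod_eqI ext)

text \<open>The letters encode twelve products: \<open>abC\<close> is (A \<circ> B) \<circ> C and
  \<open>aBC\<close> is A \<circ> (B \<circ> C), likewise for the other orders. The hypotheses are
  the pre-Lie identities with each of A, B, C in the outer left position.\<close>

lemma jacobi_combine:
  fixes aBC :: "'a::ab_group_add"
  assumes "abC - aBC = parity_sign (q * r) (acB - aCB)"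
    "baC - bAC = parity_sign (p * r) (bcA - bCA)"
    "caB - cAB = parity_sign (p * q) (cbA - cBA)"
  shows "(aBC - parity_sign (q * r) aCB) - parity_sign (p * (q + r)) (bcA - parity_sign (q * r) cbA) =
    (abC - parity_sign (p * q) baC) - parity_sign ((p + q) * r) (cAB - parity_sign (p * q) cBA) +
    parity_sign (p * q) ((bAC - parity_sign (p * r) bCA) -
      parity_sign (q * (p + r)) (acB - parity_sign (p * r) caB))"
proof -
  have "abC = aBC + parity_sign (q * r) (acB - aCB)"
    "baC = bAC + parity_sign (p * r) (bcA - bCA)"
    "caB = cAB + parity_sign (p * q) (cbA - cBA)"
    using assms by (simp_all add: algebra_simps)
  then show ?thesis
    by (cases "even p"; cases "even q"; cases "even r") (simp_all add: parity_sign_def algebra_simps)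
qed

lemma joint_circ_diff_left: "joint_circ q (F - G) Q = joint_circ q F Q - joint_circ q G Q"
  unfolding diff_conv_add_uminus by (simp only: joint_circ_add_left joint_circ_uminus_left)

lemma joint_circ_diff_right:
  "multilinear s F \<Longrightarrow> joint_circ q F (P - Q) = joint_circ q F P - joint_circ q F Q"
  unfolding diff_conv_add_uminus by (simp only: joint_circ_add_right joint_circ_uminus_right)

lemma joint_circ_jacobi:
  fixes A B C :: "'v::ab_group_add joint_cochain"
  assumes ml: "multilinear s A" "multilinear s B" "multilinear s C"
    and hom: "homogeneous p A" "homogeneous q B" "homogeneous r C"
  shows "joint_circ (q + r) A (joint_circ r B C - parity_sign (q * r) (joint_circ q C B)) -
      parity_sign (p * (q + r))
        (joint_circ p (joint_circ r B C - parity_sign (q * r) (joint_circ q C B)) A) =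
    joint_circ r (joint_circ q A B - parity_sign (p * q) (joint_circ p B A)) C -
      parity_sign ((p + q) * r)
        (joint_circ (p + q) C (joint_circ q A B - parity_sign (p * q) (joint_circ p B A))) +
    parity_sign (p * q)
      (joint_circ (p + r) B (joint_circ r A C - parity_sign (p * r) (joint_circ p C A)) -
       parity_sign (q * (p + r))
        (joint_circ q (joint_circ r A C - parity_sign (p * r) (joint_circ p C A)) B))"
proof -
  have pre_lie: "joint_circ n (joint_circ m F P) Q - joint_circ (m + n) F (joint_circ n P Q) =
      parity_sign (m * n)
        (joint_circ m (joint_circ n F Q) P - joint_circ (m + n) F (joint_circ m Q P))"
    if "multilinear s F" "multilinear s P" "multilinear s Q" "homogeneous m P" "homogeneous n Q"
    for m n and F P Q :: "'v joint_cochain"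
    using joint_circ_pre_lie[OF that(1-3) that(4,5)[THEN homogeneous_odd_part_vanishes]]
    by (intro ext) (simp add: parity_sign_apply add.commute[of n m])
  show ?thesis
    unfolding joint_circ_diff_left joint_circ_diff_right[OF ml(1)] joint_circ_diff_right[OF ml(2)]
      joint_circ_diff_right[OF ml(3)] joint_circ_parity_sign_left
      joint_circ_parity_sign_right[OF ml(1)] joint_circ_parity_sign_right[OF ml(2)]
      joint_circ_parity_sign_right[OF ml(3)]
    by (rule jacobi_combine[OF pre_lie[OF ml hom(2,3)] pre_lie[OF ml(2,1,3) hom(1,3)]
          pre_lie[OF ml(3,1,2) hom(1,2)]])
qed

section \<open>Cochains as a graded vector space\<close>

context vector_space
begin

lemma joint_cochain_scale_sign:
  "joint (cochain_scale scale ((-1) ^ n) P) = parity_sign n (joint P)"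
  by (simp add: joint_cochain_scale fun_eq_iff scale_minus_one_power parity_sign_apply)

lemma joint_lieY_bracket:
  assumes "P \<in> cochains scale p" "Q \<in> cochains scale q"
  shows "joint (lieY_bracket scale P Q) = joint_circ q (joint P) (joint Q) -
    parity_sign (p * q) (joint_circ p (joint Q) (joint P))"
  by (simp only: lieY_bracket_homogeneous[OF vector_space_axioms assms] joint_diff
      joint_cochain_scale_sign joint_circ_joint[OF assms] joint_circ_joint[OF assms(2,1)])

lemma vector_space_cochains: "vector_space (cochain_scale scale)"
  by unfold_locales
    (auto intro!: cochain_eqI simp: cochain_scale_simps scale_right_distrib scale_left_distrib)

lemma linear_map_scale:
  "Vector_Spaces.linear scale scale f \<Longrightarrow> Vector_Spaces.linear scale scale (\<lambda>x. scale c (f x))"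
  by (rule linear_mapI) (simp_all add: linear_mapD scale_right_distrib mult.commute)

lemma alternating_bilinear_scale:
  "alternating_bilinear scale f \<Longrightarrow> alternating_bilinear scale (\<lambda>x y. scale c (f x y))"
  by (intro alternating_bilinearI linear_map_scale) (simp_all add: alternating_bilinearD)

lemma multilinear_zero: "multilinear scale 0"
  by (simp add: multilinear_def linear_map_const_zero alternating_bilinear_const_zero)

lemma multilinear_add:
  "multilinear scale F \<Longrightarrow> multilinear scale G \<Longrightarrow> multilinear scale (F + G)"
  by (simp add: multilinear_def linear_map_sum alternating_bilinear_add)

lemma multilinear_scale:
  "multilinear scale F \<Longrightarrow> multilinear scale (\<lambda>Xs e. scale c (F Xs e))"
  by (simp add: multilinear_def linear_map_scale alternating_bilinear_scale)

lemma subspace_cochains: "module.subspace (cochain_scale scale) (cochains scale p)"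
proof -
  interpret C: vector_space "cochain_scale scale" by (rule vector_space_cochains)
  have joint_0: "joint (0 :: 'b cochain) = 0"
    by (simp add: joint_def fun_eq_iff split: sum.split)
  show ?thesis
  proof (rule C.subspaceI)
    show "0 \<in> cochains scale p"
      by (rule cochainsI) (simp_all only: joint_0 multilinear_zero, simp_all add: homogeneous_def)
    show "P + Q \<in> cochains scale p" if "P \<in> cochains scale p" "Q \<in> cochains scale p" for P Q
      using multilinear_joint[OF that(1)] multilinear_joint[OF that(2)]
        homogeneous_joint[OF that(1)] homogeneous_joint[OF that(2)]
        cochains_fst_Nil[OF that(1)] cochains_fst_Nil[OF that(2)]
      by (intro cochainsI; simp only: joint_add multilinear_add; simp add: homogeneous_def)
    show "cochain_scale scale c P \<in> cochains scale p" if "P \<in> cochains scale p" for c P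
      using multilinear_joint[OF that] homogeneous_joint[OF that] cochains_fst_Nil[OF that]
      by (intro cochainsI; simp only: joint_cochain_scale multilinear_scale;
          simp add: homogeneous_def cochain_scale_simps)
  qed
qed

lemma zero_cochains: "0 \<in> cochains scale p"
proof -
  interpret C: vector_space "cochain_scale scale" by (rule vector_space_cochains)
  show ?thesis by (rule C.subspace_0[OF subspace_cochains])
qed

lemma homogeneous_part_scale:
  "homogeneous_part p (cochain_scale scale c P) = cochain_scale scale c (homogeneous_part p P)"
  by (rule cochain_eqI) (simp_all add: homogeneous_part_def cochain_scale_simps)

lemma homogeneous_part_0: "homogeneous_part p (0 :: 'b cochain) = 0"
  by (rule cochain_eqI) (simp_all add: homogeneous_part_def)

text \<open>\<open>homogeneous_part p\<close> is linear, is the identity in degree \<open>p\<close>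
  and kills every other degree, hence also their span.\<close>

lemma graded_vector_space_cochains: "graded_vector_space (cochain_scale scale) (cochains scale)"
proof -
  interpret C: vector_space "cochain_scale scale" by (rule vector_space_cochains)
  have "C.subspace {P. homogeneous_part p P = 0}" for p
    by (rule C.subspaceI) (simp_all add: homogeneous_part_0 homogeneous_part_add homogeneous_part_scale)
  then have span: "C.span (\<Union>q\<in>-{p}. cochains scale q) \<subseteq> {P. homogeneous_part p P = 0}" for p
    by (rule C.span_minimal[rotated]) (auto simp: homogeneous_part_cochains)
  have "P = 0" if "P \<in> cochains scale p" "P \<in> C.span (\<Union>q\<in>-{p}. cochains scale q)" for P p
    using homogeneous_part_cochains[OF that(1), of p] subsetD[OF span that(2)] by simp
  then show ?thesis
    by unfold_locales (auto intro: subspace_cochains zero_cochains C.span_zero)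
qed

end

section \<open>Extension of the bracket to the direct sum\<close>

definition finite_cochain_sum ::
  "('k::field \<Rightarrow> 'v::ab_group_add \<Rightarrow> 'v) \<Rightarrow> 'v cochain \<Rightarrow> bool" where
  "finite_cochain_sum scale P \<longleftrightarrow>
    finite (degree_support P) \<and> (\<forall>p. homogeneous_part p P \<in> cochains scale p)"

lemma degree_support_add:
  fixes P Q :: "'v::ab_group_add cochain"
  shows "degree_support (P + Q) \<subseteq> degree_support P \<union> degree_support Q"
  by (auto simp: degree_support_def homogeneous_part_add)

context vector_space
begin

lemma degree_support_scale: "degree_support (cochain_scale scale c P) \<subseteq> degree_support P"
proof -
  interpret C: vector_space "cochain_scale scale" by (rule vector_space_cochains)
  show ?thesis
    by (auto simp: degree_support_def homogeneous_part_scale)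
qed

lemma circ_add_left:
  assumes "P \<in> cochains scale p" "P' \<in> cochains scale p" "Q \<in> cochains scale q"
  shows "circ scale p q (P + P') Q = circ scale p q P Q + circ scale p q P' Q"
proof (rule joint_eqI)
  interpret C: vector_space "cochain_scale scale" by (rule vector_space_cochains)
  note add = C.subspace_add[OF subspace_cochains assms(1,2)]
  show "joint (circ scale p q (P + P') Q) = joint (circ scale p q P Q + circ scale p q P' Q)"
    by (simp only: joint_add joint_circ_joint[OF assms(1,3)] joint_circ_joint[OF assms(2,3)]
        joint_circ_joint[OF add assms(3)] joint_circ_add_left)
  show "fst (circ scale p q (P + P') Q) [] = fst (circ scale p q P Q + circ scale p q P' Q) []"
    by (simp add: circ_fst_Nil[OF assms(1,3)] circ_fst_Nil[OF assms(2,3)]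
        circ_fst_Nil[OF add assms(3)])
qed

lemma circ_add_right:
  assumes "P \<in> cochains scale p" "Q \<in> cochains scale q" "Q' \<in> cochains scale q"
  shows "circ scale p q P (Q + Q') = circ scale p q P Q + circ scale p q P Q'"
proof (rule joint_eqI)
  interpret C: vector_space "cochain_scale scale" by (rule vector_space_cochains)
  note add = C.subspace_add[OF subspace_cochains assms(2,3)]
  show "joint (circ scale p q P (Q + Q')) = joint (circ scale p q P Q + circ scale p q P Q')"
    by (simp only: joint_add joint_circ_joint[OF assms(1,2)] joint_circ_joint[OF assms(1,3)]
        joint_circ_joint[OF assms(1) add] joint_circ_add_right[OF multilinear_joint[OF assms(1)]])
  show "fst (circ scale p q P (Q + Q')) [] = fst (circ scale p q P Q + circ scale p q P Q') []"
    by (simp add: circ_fst_Nil[OF assms(1,2)] circ_fst_Nil[OF assms(1,3)]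
        circ_fst_Nil[OF assms(1) add])
qed

lemma circ_scale_left:
  assumes "P \<in> cochains scale p" "Q \<in> cochains scale q"
  shows "circ scale p q (cochain_scale scale c P) Q = cochain_scale scale c (circ scale p q P Q)"
proof (rule joint_eqI)
  interpret C: vector_space "cochain_scale scale" by (rule vector_space_cochains)
  note sc = C.subspace_scale[OF subspace_cochains assms(1)]
  show "joint (circ scale p q (cochain_scale scale c P) Q) =
      joint (cochain_scale scale c (circ scale p q P Q))"
    by (simp only: joint_cochain_scale joint_circ_joint[OF sc assms(2)] joint_circ_joint[OF assms]
        joint_circ_scale_left)
  show "fst (circ scale p q (cochain_scale scale c P) Q) [] =
      fst (cochain_scale scale c (circ scale p q P Q)) []"
    by (simp add: circ_fst_Nil[OF assms] circ_fst_Nil[OF sc assms(2)] cochain_scale_simps)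
qed

lemma circ_scale_right:
  assumes "P \<in> cochains scale p" "Q \<in> cochains scale q"
  shows "circ scale p q P (cochain_scale scale c Q) = cochain_scale scale c (circ scale p q P Q)"
proof (rule joint_eqI)
  interpret C: vector_space "cochain_scale scale" by (rule vector_space_cochains)
  note sc = C.subspace_scale[OF subspace_cochains assms(2)]
  show "joint (circ scale p q P (cochain_scale scale c Q)) =
      joint (cochain_scale scale c (circ scale p q P Q))"
    by (simp only: joint_cochain_scale joint_circ_joint[OF assms(1) sc] joint_circ_joint[OF assms]
        joint_circ_scale_right[OF multilinear_joint[OF assms(1)]])
  show "fst (circ scale p q P (cochain_scale scale c Q)) [] =
      fst (cochain_scale scale c (circ scale p q P Q)) []"
    by (simp add: circ_fst_Nil[OF assms] circ_fst_Nil[OF assms(1) sc] cochain_scale_simps)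
qed

lemma graded_commutator_bilinear:
  assumes "P \<in> cochains scale p" "P' \<in> cochains scale p" "Q \<in> cochains scale q" "Q' \<in> cochains scale q"
  shows "graded_commutator scale p q (P + P') Q =
      graded_commutator scale p q P Q + graded_commutator scale p q P' Q"
    "graded_commutator scale p q P (Q + Q') =
      graded_commutator scale p q P Q + graded_commutator scale p q P Q'"
    "graded_commutator scale p q (cochain_scale scale c P) Q =
      cochain_scale scale c (graded_commutator scale p q P Q)"
    "graded_commutator scale p q P (cochain_scale scale c Q) =
      cochain_scale scale c (graded_commutator scale p q P Q)"
proof -
  interpret C: vector_space "cochain_scale scale" by (rule vector_space_cochains)
  show "graded_commutator scale p q (P + P') Q =
      graded_commutator scale p q P Q + graded_commutator scale p q P' Q"
    using assms by (simp add: graded_commutator_def circ_add_left circ_add_right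
        C.scale_right_distrib)
  show "graded_commutator scale p q P (Q + Q') =
      graded_commutator scale p q P Q + graded_commutator scale p q P Q'"
    using assms by (simp add: graded_commutator_def circ_add_left circ_add_right
        C.scale_right_distrib)
  show "graded_commutator scale p q (cochain_scale scale c P) Q =
      cochain_scale scale c (graded_commutator scale p q P Q)"
    using assms by (simp add: graded_commutator_def circ_scale_left circ_scale_right
        C.scale_right_diff_distrib C.scale_left_commute)
  show "graded_commutator scale p q P (cochain_scale scale c Q) =
      cochain_scale scale c (graded_commutator scale p q P Q)"
    using assms by (simp add: graded_commutator_def circ_scale_left circ_scale_right
        C.scale_right_diff_distrib C.scale_left_commute)
qed

lemma graded_commutator_zero:
  assumes "P \<in> cochains scale p"
  shows "graded_commutator scale p q P 0 = 0" "graded_commutator scale q p 0 P = 0"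
proof -
  interpret C: vector_space "cochain_scale scale" by (rule vector_space_cochains)
  show "graded_commutator scale p q P 0 = 0" "graded_commutator scale q p 0 P = 0"
    by (simp_all add: graded_commutator_def circ_zero_left[OF vector_space_axioms]
        circ_zero_right[OF vector_space_axioms assms])
qed

text \<open>The supports of \<open>P\<close>, \<open>P'\<close> and \<open>P + P'\<close> may differ
  by cancellation; summing over common larger index sets makes the brackets comparable term by
  term.\<close>

lemma lieY_bracket_eq_sum:
  assumes "finite_cochain_sum scale P" "finite_cochain_sum scale Q"
    and "finite S" "degree_support P \<subseteq> S" "finite T" "degree_support Q \<subseteq> T"
  shows "lieY_bracket scale P Q = (\<Sum>p\<in>S. \<Sum>q\<in>T.
    graded_commutator scale p q (homogeneous_part p P) (homogeneous_part q Q))"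
proof -
  have "(\<Sum>q\<in>degree_support Q.
      graded_commutator scale p q (homogeneous_part p P) (homogeneous_part q Q)) =
    (\<Sum>q\<in>T. graded_commutator scale p q (homogeneous_part p P) (homogeneous_part q Q))" for p
    using assms graded_commutator_zero(1)
    by (intro sum.mono_neutral_left) (auto simp: finite_cochain_sum_def degree_support_def)
  moreover have "(\<Sum>p\<in>degree_support P. \<Sum>q\<in>T.
      graded_commutator scale p q (homogeneous_part p P) (homogeneous_part q Q)) =
    (\<Sum>p\<in>S. \<Sum>q\<in>T.
      graded_commutator scale p q (homogeneous_part p P) (homogeneous_part q Q))"
    using assms graded_commutator_zero(2)
    by (intro sum.mono_neutral_left)
      (auto simp: finite_cochain_sum_def degree_support_def intro!: sum.neutral)
  ultimately show ?thesis
    by (simp add: lieY_bracket_def)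
qed

text \<open>The finite sums form a subspace that contains every component, hence the span of all
  components.\<close>

lemma total_finite_cochain_sum:
  assumes "P \<in> graded_vector_space.total (cochain_scale scale) (cochains scale)"
  shows "finite_cochain_sum scale P"
proof -
  interpret G: graded_vector_space "cochain_scale scale" "cochains scale"
    by (rule graded_vector_space_cochains)
  have "G.subspace {P. finite_cochain_sum scale P}"
  proof (rule G.subspaceI)
    have "degree_support (0 :: 'b cochain) = {}"
      by (simp add: degree_support_def homogeneous_part_0)
    then show "0 \<in> {P. finite_cochain_sum scale P}"
      by (simp add: finite_cochain_sum_def homogeneous_part_0 zero_cochains)
    show "P + Q \<in> {P. finite_cochain_sum scale P}"
      if "P \<in> {P. finite_cochain_sum scale P}" "Q \<in> {P. finite_cochain_sum scale P}" for P Q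
      using that finite_subset[OF degree_support_add[of P Q]]
      by (auto simp: finite_cochain_sum_def homogeneous_part_add
          intro: G.subspace_add[OF subspace_cochains])
    show "cochain_scale scale c P \<in> {P. finite_cochain_sum scale P}"
      if "P \<in> {P. finite_cochain_sum scale P}" for c P
      using that finite_subset[OF degree_support_scale[of c P]]
      by (auto simp: finite_cochain_sum_def homogeneous_part_scale
          intro: G.subspace_scale[OF subspace_cochains])
  qed
  moreover have "finite_cochain_sum scale P" if "P \<in> cochains scale p" for P p
    using that finite_subset[of "degree_support P" "{p}"]
    by (auto simp: finite_cochain_sum_def homogeneous_part_cochains[OF that] degree_support_def
        zero_cochains split: if_splits)
  ultimately have "G.total \<subseteq> {P. finite_cochain_sum scale P}"
    unfolding G.total_def by (intro G.span_minimal) auto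
  with assms show ?thesis by auto
qed

lemma lieY_bracket_bilinear:
  assumes P: "finite_cochain_sum scale P" and P': "finite_cochain_sum scale P'"
    and PP': "finite_cochain_sum scale (P + P')"
    and cP: "finite_cochain_sum scale (cochain_scale scale c P)"
    and Q: "finite_cochain_sum scale Q"
  shows "lieY_bracket scale (P + P') Q = lieY_bracket scale P Q + lieY_bracket scale P' Q"
    "lieY_bracket scale Q (P + P') = lieY_bracket scale Q P + lieY_bracket scale Q P'"
    "lieY_bracket scale (cochain_scale scale c P) Q = cochain_scale scale c (lieY_bracket scale P Q)"
    "lieY_bracket scale Q (cochain_scale scale c P) = cochain_scale scale c (lieY_bracket scale Q P)"
proof -
  interpret C: vector_space "cochain_scale scale" by (rule vector_space_cochains)
  let ?S = "degree_support P \<union> degree_support P'" and ?T = "degree_support Q"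
  have fin: "finite ?S" "finite ?T"
    using P P' Q by (simp_all add: finite_cochain_sum_def)
  have mem: "homogeneous_part p P \<in> cochains scale p" "homogeneous_part p P' \<in> cochains scale p"
    "homogeneous_part p Q \<in> cochains scale p" for p
    using P P' Q by (simp_all add: finite_cochain_sum_def)
  note left = lieY_bracket_eq_sum[OF _ Q fin(1) _ fin(2) order_refl]
    and right = lieY_bracket_eq_sum[OF Q _ fin(2) order_refl fin(1)]
  have sub: "degree_support P \<subseteq> ?S" "degree_support P' \<subseteq> ?S" "degree_support (P + P') \<subseteq> ?S"
    "degree_support (cochain_scale scale c P) \<subseteq> ?S"
    using degree_support_add[of P P'] degree_support_scale[of c P] by auto
  show "lieY_bracket scale (P + P') Q = lieY_bracket scale P Q + lieY_bracket scale P' Q"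
    unfolding left[OF PP' sub(3)] left[OF P sub(1)] left[OF P' sub(2)] homogeneous_part_add
    by (simp only: graded_commutator_bilinear(1)[OF mem(1) mem(2) mem(3) mem(3)] sum.distrib)
  show "lieY_bracket scale Q (P + P') = lieY_bracket scale Q P + lieY_bracket scale Q P'"
    unfolding right[OF PP' sub(3)] right[OF P sub(1)] right[OF P' sub(2)] homogeneous_part_add
    by (simp only: graded_commutator_bilinear(2)[OF mem(3) mem(3) mem(1) mem(2)] sum.distrib)
  show "lieY_bracket scale (cochain_scale scale c P) Q = cochain_scale scale c (lieY_bracket scale P Q)"
    unfolding left[OF cP sub(4)] left[OF P sub(1)] homogeneous_part_scale
    by (simp only: graded_commutator_bilinear(3)[OF mem(1) mem(1) mem(3) mem(3)] C.scale_sum_right)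
  show "lieY_bracket scale Q (cochain_scale scale c P) = cochain_scale scale c (lieY_bracket scale Q P)"
    unfolding right[OF cP sub(4)] right[OF P sub(1)] homogeneous_part_scale
    by (simp only: graded_commutator_bilinear(4)[OF mem(3) mem(3) mem(1) mem(1)] C.scale_sum_right)
qed

lemma lieY_bracket_cochains:
  assumes "P \<in> cochains scale p" "Q \<in> cochains scale q"
  shows "lieY_bracket scale P Q \<in> cochains scale (p + q)"
proof -
  interpret C: vector_space "cochain_scale scale" by (rule vector_space_cochains)
  show ?thesis
    using circ_cochains[OF assms] circ_cochains[OF assms(2,1)]
    by (simp add: lieY_bracket_homogeneous[OF vector_space_axioms assms] add.commute
        C.subspace_diff[OF subspace_cochains] C.subspace_scale[OF subspace_cochains])
qed

lemma graded_lie_algebra_lieY: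
  "graded_lie_algebra (cochain_scale scale) (cochains scale) (lieY_bracket scale)"
proof -
  interpret G: graded_vector_space "cochain_scale scale" "cochains scale"
    by (rule graded_vector_space_cochains)
  note fin = total_finite_cochain_sum
  show ?thesis
  proof unfold_locales
    fix a b c :: "'b cochain" and t
    assume a: "a \<in> G.total" and b: "b \<in> G.total"
    have sub: "G.subspace G.total"
      unfolding G.total_def by (rule G.subspace_span)
    note sc = G.subspace_scale[OF sub]
    show "lieY_bracket scale (cochain_scale scale t a) b = cochain_scale scale t (lieY_bracket scale a b)"
      "lieY_bracket scale a (cochain_scale scale t b) = cochain_scale scale t (lieY_bracket scale a b)"
      using lieY_bracket_bilinear(3,4)[OF fin fin fin[OF G.subspace_add[OF sub]] fin[OF sc] fin] a b
      by blast+
    assume c: "c \<in> G.total"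
    show "lieY_bracket scale (a + b) c = lieY_bracket scale a c + lieY_bracket scale b c"
      "lieY_bracket scale a (b + c) = lieY_bracket scale a b + lieY_bracket scale a c"
      using lieY_bracket_bilinear(1,2)[OF fin fin fin[OF G.subspace_add[OF sub]] fin[OF sc] fin] a b c
      by blast+
  next
    fix a b :: "'b cochain" and p q
    assume a: "a \<in> cochains scale p" and b: "b \<in> cochains scale q"
    show "lieY_bracket scale a b \<in> cochains scale (p + q)"
      by (rule lieY_bracket_cochains[OF a b])
    show "lieY_bracket scale a b = - cochain_scale scale ((-1) ^ (p * q)) (lieY_bracket scale b a)"
      unfolding lieY_bracket_homogeneous[OF vector_space_axioms a b]
        lieY_bracket_homogeneous[OF vector_space_axioms b a]
      by (simp add: G.scale_right_diff_distrib mult.commute[of q p] power_add[symmetric] mult_2[symmetric])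
    fix c :: "'b cochain" and r
    assume c: "c \<in> cochains scale r"
    note ab = lieY_bracket_cochains[OF a b] and ac = lieY_bracket_cochains[OF a c]
      and bc = lieY_bracket_cochains[OF b c]
    show "lieY_bracket scale a (lieY_bracket scale b c) = lieY_bracket scale (lieY_bracket scale a b) c +
      cochain_scale scale ((-1) ^ (p * q)) (lieY_bracket scale b (lieY_bracket scale a c))"
    proof (rule joint_eqI)
      show "joint (lieY_bracket scale a (lieY_bracket scale b c)) =
        joint (lieY_bracket scale (lieY_bracket scale a b) c +
          cochain_scale scale ((-1) ^ (p * q)) (lieY_bracket scale b (lieY_bracket scale a c)))"
        unfolding joint_add joint_cochain_scale_sign joint_lieY_bracket[OF a bc]
          joint_lieY_bracket[OF ab c] joint_lieY_bracket[OF b ac] joint_lieY_bracket[OF a b]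
          joint_lieY_bracket[OF a c] joint_lieY_bracket[OF b c]
        by (rule joint_circ_jacobi) (rule multilinear_joint homogeneous_joint a b c)+
      show "fst (lieY_bracket scale a (lieY_bracket scale b c)) [] =
        fst (lieY_bracket scale (lieY_bracket scale a b) c +
          cochain_scale scale ((-1) ^ (p * q)) (lieY_bracket scale b (lieY_bracket scale a c))) []"
        by (simp add: cochain_scale_simps cochains_fst_Nil[OF lieY_bracket_cochains[OF a bc]]
            cochains_fst_Nil[OF lieY_bracket_cochains[OF ab c]]
            cochains_fst_Nil[OF lieY_bracket_cochains[OF b ac]])
    qed
  qed
qed

text \<open>In degree 1 the sign (-1)^(pq) is -1, so the bracket is P \<circ> P taken twice. The
  product has degree 2: its arguments are two pairs and a vector, or one pair and an end
  pair.\<close>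

lemma lie_yamaguti_maurer_cartan:
  assumes P: "P \<in> cochains scale 1"
    and ly: "lie_yamaguti_algebra scale (\<lambda>x y. fst P [(x, y)]) (\<lambda>x y z. snd P [(x, y)] z)"
  shows "maurer_cartan_element (cochains scale) (lieY_bracket scale) P"
proof -
  interpret lie_yamaguti_algebra scale "\<lambda>x y. fst P [(x, y)]" "\<lambda>x y z. snd P [(x, y)] z"
    by (rule ly)
  have van: "fst P Xs = 0" "snd P Xs x = 0" if "length Xs \<noteq> 1" for Xs x
    using P that by (auto simp: cochains_def hom_I_def hom_II_def)
  have hom: "homogeneous (1 + 1) (joint_circ 1 (joint P) (joint P))"
    by (rule homogeneous_joint_circ[OF homogeneous_joint[OF P] multilinear_joint[OF P]
          homogeneous_joint[OF P]])
  note zero = alternating_bilinear_zero[OF cochains_I_alternating[OF P, of "[]" "[]", simplified]]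
    alternating_bilinear_zero[OF cochains_II_alternating[OF P, of "[]" "[]", simplified]]
  have "joint_circ 1 (joint P) (joint P) Xs e = 0" for Xs e
  proof (cases e)
    case (Inl z)
    show ?thesis
    proof (cases "length Xs = 2")
      case True
      \<comment> \<open>As \<open>P\<close> vanishes off length 1, only four terms survive; they
        form the right side of \<open>LY4\<close> minus its left side.\<close>
      then obtain x y u v where "Xs = [(x, y), (u, v)]"
        by (auto simp: length_Suc_conv numeral_2_eq_2)
      then show ?thesis
        using LY4[of x y u v z] Inl
        by (simp add: contract_def parity_sign_def van zero cochains_II_zero[OF P])
    next
      case False
      then show ?thesis using hom Inl by (simp add: homogeneous_def)
    qed
  next
    case (Inr X)
    obtain u v where X: "X = (u, v)" by force
    show ?thesis
    proof (cases "length Xs = 1")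
      case True
      \<comment> \<open>Three terms survive here, the right side of \<open>LY3\<close> minus its
        left side.\<close>
      then obtain x y where "Xs = [(x, y)]"
        by (auto simp: length_Suc_conv)
      then show ?thesis
        using LY3[of x y u v] Inr X
        by (simp add: contract_def parity_sign_def van zero cochains_II_zero[OF P])
    next
      case False
      then show ?thesis using hom Inr X by (simp add: homogeneous_def)
    qed
  qed
  then have "joint (circ scale 1 1 P P) = joint 0"
    unfolding joint_circ_joint[OF P P] by (simp add: fun_eq_iff joint_def split: sum.split)
  then have "circ scale 1 1 P P = 0"
    using circ_fst_Nil[OF P P] by (intro joint_eqI) simp_all
  then show ?thesis
    using P by (simp add: maurer_cartan_element_def
        lieY_bracket_homogeneous[OF vector_space_axioms P P] cochain_scale_def fun_eq_iff zero_prod_def)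
qed

end

theorem theorem3p1:
  fixes scale :: "'k::field_char_0 \<Rightarrow> 'v::ab_group_add \<Rightarrow> 'v"
  assumes "vector_space scale"
  shows "graded_lie_algebra (cochain_scale scale) (cochains scale) (lieY_bracket scale) \<and>
    (\<forall>P \<in> cochains scale 1.
      lie_yamaguti_algebra scale (\<lambda>x y. fst P [(x, y)]) (\<lambda>x y z. snd P [(x, y)] z) \<longrightarrow>
      maurer_cartan_element (cochains scale) (lieY_bracket scale) P)"
  using vector_space.graded_lie_algebra_lieY[OF assms]
    vector_space.lie_yamaguti_maurer_cartan[OF assms] by blast

end
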